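(* Let $\lambda\in\mathbf{k}$. The Rota–Baxter species $(\mathrm{ADF},\diamond,\bullet,R)$ of weight $\lambda$, together with the morphism of species $i:O\to\mathrm{ADF}$, is the free Rota–Baxter species of weight $\lambda$ on $O$: for every Rota–Baxter species $(Q,m,1_Q,R')$ of weight $\lambda$ and every morphism of species $g:O\to Q$, there is a unique morphism of Rota–Baxter species $\overline{g}:\mathrm{ADF}\to Q$ such that $g=\overline{g}\circ i$.
   Context: $\mathbf{k}$ is a field of characteristic zero. A species is a functor from finite sets with bijections to $\mathbf{k}$-vector spaces; a morphism of species is a natural transformation. A twisted algebra is a species $P$ with natural maps $m_{X,Y}:P[X]\otimes P[Y]\to P[X\sqcup Y]$ (for disjoint finite sets) that are associative and have a unit $1_P\in P[\emptyset]$. A Rota–Baxter species of weight $\lambda$ is a twisted algebra $(P,m,1_P)$ with a morphism of species $R:P\to P$ such that $m_{X,Y}(R_X(x)\otimes R_Y(y))=R_{X\sqcup Y}\big(m_{X,Y}(R_X(x)\otimes y+x\otimes R_Y(y)+\lambda x\otimes y)\big)$ for all $x\in P[X]$, $y\in P[Y]$. A morphism of Rota–Baxter species $f:(P,m,1_P,R)\to(P',m',1_{P'},R')$ is a morphism of species with $f\circ m=m'\circ(f\otimes f)$, $f(1_P)=1_{P'}$, $f\circ R=R'\circ f$. Angularly decorated forests: a planar rooted forest $T_1\cdots T_n$ with $\ell$ leaves has $\ell-1$ angles (gaps between consecutive leaves left to right, inside a tree or between adjacent trees), written $T_1x_1T_2\cdots x_{n-1}T_n$; $\bullet$ is the one-vertex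 tree. For a finite set $X$, $\mathrm{ADF}[X]$ is the vector space with basis the forests with exactly $|X|$ angles decorated bijectively by $X$; $\mathrm{ADF}[\sigma]$ relabels decorations along a bijection $\sigma$. $B^+$ adds a new root joined to the roots of all trees, keeping decorations; every tree other than $\bullet$ is $B^+$ of a unique forest. Depth of a tree = maximal root-to-leaf path length; of a forest = max over its trees. The product $\diamond$ of weight $\lambda$ is defined bilinearly by induction on the sum of depths: for trees, $\bullet\diamond\bullet=\bullet$, $T\diamond\bullet=T$, $\bullet\diamond T'=T'$, $B^+(A)\diamond B^+(A')=B^+(B^+(A)\diamond A')+B^+(A\diamond B^+(A'))+\lambda B^+(A\diamond A')$; for forests $F=T_1x_1\cdots x_mT_{m+1}$, $G=T'_1y_1\cdots y_nT'_{n+1}$, $F\diamond G=T_1x_1\cdots x_m(T_{m+1}\diamond T'_1)y_1T'_2\cdots y_nT'_{n+1}$. The twisted algebra structure on $\mathrm{ADF}$ is $m_{X,Y}(F\otimes G)=F\diamond G$ with unit $\bullet$, and $R_X(F)=B^+(F)$. The species $O$ has $O[\{x\}]=\mathbf{k}\,\bullet x\bullet$ (the forest of two one-vertex trees separated by an angle decorated by $x$) for singletons, $O[X]=0$ otherwise, with $O[\sigma](\bullet x\bullet)=\bullet\sigma(x)\bullet$; $i:O\to\mathrm{ADF}$ is the natural inclusion on singletons and $0$ otherwise. *)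

theory Defs
  imports
    "Jordan_Normal_Form.VS_Connect"
    "HOL-Library.Poly_Mapping"
    "HOL-Library.Infinite_Typeclass"
begin

section \<open>Species and Rota--Baxter species\<close>

text \<open>
  The finite sets are the finite subsets of a type \<^typ>\<open>'x\<close>; when \<^typ>\<open>'x\<close> is infinite, these with
  their bijections form a category equivalent to that of all finite sets.  An arrow with source
  \<open>X\<close> is given by a function \<open>\<sigma>\<close> injective on \<open>X\<close> and has target \<open>\<sigma> ` X\<close>; functions that agree on
  \<open>X\<close> are the same arrow (axiom \<open>arr_cong\<close> below).  Every \<open>obj P X\<close> carries its own vector space
  operations, and no relation between the spaces for different \<open>X\<close> is assumed.
\<close>

record ('x, 'k, 'v) species_data =
  obj :: "'x set \<Rightarrow> ('k, 'v) module"
  arr :: "'x set \<Rightarrow> ('x \<Rightarrow> 'x) \<Rightarrow> 'v \<Rightarrow> 'v"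

locale species =
  fixes P :: "('x, 'k :: field_char_0, 'v, 'z) species_data_scheme"
  assumes obj_vectorspace: "finite X \<Longrightarrow> vectorspace class_ring (obj P X)"
    and arr_linear: "\<lbrakk>finite X; bij_betw \<sigma> X Y\<rbrakk>
      \<Longrightarrow> linear_map class_ring (obj P X) (obj P Y) (arr P X \<sigma>)"
    and arr_cong: "\<lbrakk>finite X; bij_betw \<sigma> X Y; \<forall>x\<in>X. \<tau> x = \<sigma> x; v \<in> carrier (obj P X)\<rbrakk>
      \<Longrightarrow> arr P X \<tau> v = arr P X \<sigma> v"
    and arr_id: "\<lbrakk>finite X; v \<in> carrier (obj P X)\<rbrakk> \<Longrightarrow> arr P X id v = v"
    and arr_comp: "\<lbrakk>finite X; bij_betw \<sigma> X Y; bij_betw \<tau> Y Z; v \<in> carrier (obj P X)\<rbrakk>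
      \<Longrightarrow> arr P X (\<tau> \<circ> \<sigma>) v = arr P Y \<tau> (arr P X \<sigma> v)"

locale species_morphism = source: species P + target: species P'
  for P :: "('x, 'k :: field_char_0, 'v, 'z) species_data_scheme"
    and P' :: "('x, 'k, 'w, 'y) species_data_scheme" +
  fixes f :: "'x set \<Rightarrow> 'v \<Rightarrow> 'w"
  assumes linear: "finite X \<Longrightarrow> linear_map class_ring (obj P X) (obj P' X) (f X)"
    and natural: "\<lbrakk>finite X; bij_betw \<sigma> X Y; v \<in> carrier (obj P X)\<rbrakk>
      \<Longrightarrow> f Y (arr P X \<sigma> v) = arr P' X \<sigma> (f X v)"

record ('x, 'k, 'v) twisted_data = "('x, 'k, 'v) species_data" +
  tprod :: "'x set \<Rightarrow> 'x set \<Rightarrow> 'v \<Rightarrow> 'v \<Rightarrow> 'v"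
  tunit :: 'v

text \<open>
  A linear map \<open>P[X] \<otimes> P[Y] \<rightarrow> P[X \<squnion> Y]\<close> is given as the corresponding bilinear map
  \<open>P[X] \<times> P[Y] \<rightarrow> P[X \<squnion> Y]\<close>.
\<close>

locale twisted_algebra = species P
  for P :: "('x, 'k :: field_char_0, 'v, 'z) twisted_data_scheme" +
  assumes tprod_linear_right: "\<lbrakk>finite X; finite Y; X \<inter> Y = {}; a \<in> carrier (obj P X)\<rbrakk>
      \<Longrightarrow> linear_map class_ring (obj P Y) (obj P (X \<union> Y)) (\<lambda>b. tprod P X Y a b)"
    and tprod_linear_left: "\<lbrakk>finite X; finite Y; X \<inter> Y = {}; b \<in> carrier (obj P Y)\<rbrakk>
      \<Longrightarrow> linear_map class_ring (obj P X) (obj P (X \<union> Y)) (\<lambda>a. tprod P X Y a b)"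
    and tprod_natural: "\<lbrakk>finite X; finite Y; X \<inter> Y = {}; inj_on \<sigma> (X \<union> Y);
        a \<in> carrier (obj P X); b \<in> carrier (obj P Y)\<rbrakk>
      \<Longrightarrow> arr P (X \<union> Y) \<sigma> (tprod P X Y a b)
        = tprod P (\<sigma> ` X) (\<sigma> ` Y) (arr P X \<sigma> a) (arr P Y \<sigma> b)"
    and tprod_assoc: "\<lbrakk>finite X; finite Y; finite Z; X \<inter> Y = {}; X \<inter> Z = {}; Y \<inter> Z = {};
        a \<in> carrier (obj P X); b \<in> carrier (obj P Y); c \<in> carrier (obj P Z)\<rbrakk>
      \<Longrightarrow> tprod P (X \<union> Y) Z (tprod P X Y a b) c = tprod P X (Y \<union> Z) a (tprod P Y Z b c)"
    and tunit_closed: "tunit P \<in> carrier (obj P {})"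
    and tunit_left: "\<lbrakk>finite X; a \<in> carrier (obj P X)\<rbrakk> \<Longrightarrow> tprod P {} X (tunit P) a = a"
    and tunit_right: "\<lbrakk>finite X; a \<in> carrier (obj P X)\<rbrakk> \<Longrightarrow> tprod P X {} a (tunit P) = a"

record ('x, 'k, 'v) rota_baxter_data = "('x, 'k, 'v) twisted_data" +
  rb_op :: "'x set \<Rightarrow> 'v \<Rightarrow> 'v"

locale rota_baxter_species = twisted_algebra P + rb: species_morphism P P "rb_op P"
  for P :: "('x, 'k :: field_char_0, 'v, 'z) rota_baxter_data_scheme" +
  fixes lam :: 'k
  assumes rota_baxter: "\<lbrakk>finite X; finite Y; X \<inter> Y = {};
        x \<in> carrier (obj P X); y \<in> carrier (obj P Y)\<rbrakk>
      \<Longrightarrow> tprod P X Y (rb_op P X x) (rb_op P Y y)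
        = rb_op P (X \<union> Y)
            (tprod P X Y (rb_op P X x) y \<oplus>\<^bsub>obj P (X \<union> Y)\<^esub> tprod P X Y x (rb_op P Y y)
              \<oplus>\<^bsub>obj P (X \<union> Y)\<^esub> lam \<odot>\<^bsub>obj P (X \<union> Y)\<^esub> tprod P X Y x y)"

locale rota_baxter_morphism = species_morphism P P' f
  for P :: "('x, 'k :: field_char_0, 'v, 'z) rota_baxter_data_scheme"
    and P' :: "('x, 'k, 'w, 'y) rota_baxter_data_scheme"
    and f :: "'x set \<Rightarrow> 'v \<Rightarrow> 'w" +
  assumes tprod_hom: "\<lbrakk>finite X; finite Y; X \<inter> Y = {};
        a \<in> carrier (obj P X); b \<in> carrier (obj P Y)\<rbrakk>
      \<Longrightarrow> f (X \<union> Y) (tprod P X Y a b) = tprod P' X Y (f X a) (f Y b)"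
    and tunit_hom: "f {} (tunit P) = tunit P'"
    and rb_op_hom: "\<lbrakk>finite X; a \<in> carrier (obj P X)\<rbrakk>
      \<Longrightarrow> f X (rb_op P X a) = rb_op P' X (f X a)"

section \<open>Angularly decorated forests\<close>

text \<open>
  \<open>Angle T x F\<close> is the forest \<open>T x F\<close>: the tree \<open>T\<close>, then the forest \<open>F\<close>, the angle between the last
  leaf of \<open>T\<close> and the first leaf of \<open>F\<close> being decorated by \<open>x\<close>.  All forests are nonempty.
\<close>

datatype 'x adtree = Bullet | Bplus "'x adforest"
  and 'x adforest = Tree "'x adtree" | Angle "'x adtree" 'x "'x adforest"

primrec tree_leaves :: "'x adtree \<Rightarrow> nat" and forest_leaves :: "'x adforest \<Rightarrow> nat" where
  "tree_leaves Bullet = 1"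
| "tree_leaves (Bplus F) = forest_leaves F"
| "forest_leaves (Tree T) = tree_leaves T"
| "forest_leaves (Angle T x F) = tree_leaves T + forest_leaves F"

text \<open>The decorations of all angles, from left to right.\<close>

primrec tree_angles :: "'x adtree \<Rightarrow> 'x list" and forest_angles :: "'x adforest \<Rightarrow> 'x list" where
  "tree_angles Bullet = []"
| "tree_angles (Bplus F) = forest_angles F"
| "forest_angles (Tree T) = tree_angles T"
| "forest_angles (Angle T x F) = tree_angles T @ x # forest_angles F"

lemma leaves_eq_Suc_angles:
  fixes T :: "'x adtree" and F :: "'x adforest"
  shows "tree_leaves T = Suc (length (tree_angles T))"
    and "forest_leaves F = Suc (length (forest_angles F))"
  by (induction T and F) auto

definition decorated_forests :: "'x set \<Rightarrow> 'x adforest set" where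
  "decorated_forests X = {F. distinct (forest_angles F) \<and> set (forest_angles F) = X}"

text \<open>Free vector spaces are modelled by finitely supported functions on the basis.\<close>

definition scale :: "'k :: field \<Rightarrow> ('a \<Rightarrow>\<^sub>0 'k) \<Rightarrow> ('a \<Rightarrow>\<^sub>0 'k)" where
  "scale c p = Poly_Mapping.map ((*) c) p"

definition linear_ext :: "('a \<Rightarrow> 'b) \<Rightarrow> ('a \<Rightarrow>\<^sub>0 'k :: field) \<Rightarrow> ('b \<Rightarrow>\<^sub>0 'k)" where
  "linear_ext h p =
    (\<Sum>a\<in>Poly_Mapping.keys p. Poly_Mapping.single (h a) (Poly_Mapping.lookup p a))"

definition bilinear_ext ::
    "('a \<Rightarrow> 'b \<Rightarrow> ('c \<Rightarrow>\<^sub>0 'k)) \<Rightarrow> ('a \<Rightarrow>\<^sub>0 'k :: field) \<Rightarrow> ('b \<Rightarrow>\<^sub>0 'k) \<Rightarrow> ('c \<Rightarrow>\<^sub>0 'k)" where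
  "bilinear_ext h p q = (\<Sum>a\<in>Poly_Mapping.keys p. \<Sum>b\<in>Poly_Mapping.keys q.
    scale (Poly_Mapping.lookup p a * Poly_Mapping.lookup q b) (h a b))"

text \<open>The \<open>mult\<close> and \<open>one\<close> fields of a module record play no role in the vector space structure.\<close>

definition free_space :: "'a set \<Rightarrow> ('k :: field, 'a \<Rightarrow>\<^sub>0 'k) module" where
  "free_space B = \<lparr>carrier = {p. Poly_Mapping.keys p \<subseteq> B},
    mult = undefined, one = undefined, zero = 0, add = (+), smult = scale\<rparr>"

primrec tree_weight :: "'x adtree \<Rightarrow> nat" and forest_weight :: "'x adforest \<Rightarrow> nat" where
  "tree_weight Bullet = 0"
| "tree_weight (Bplus F) = forest_weight F + 2"
| "forest_weight (Tree T) = tree_weight T + 1"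
| "forest_weight (Angle T x F) = tree_weight T + forest_weight F + 1"

text \<open>
  The product of weight \<open>lam\<close> on basis elements.  Unfolding the last equation along the trees of
  \<open>F = T\<^sub>1 x\<^sub>1 \<dots> x\<^sub>m T\<^sub>m\<^sub>+\<^sub>1\<close> gives \<open>T\<^sub>1 x\<^sub>1 \<dots> x\<^sub>m (T\<^sub>m\<^sub>+\<^sub>1 \<diamond> T'\<^sub>1) y\<^sub>1 T'\<^sub>2 \<dots> y\<^sub>n T'\<^sub>n\<^sub>+\<^sub>1\<close>.
\<close>

function (sequential)
  tree_diamond :: "'k :: field \<Rightarrow> 'x adtree \<Rightarrow> 'x adtree \<Rightarrow> ('x adtree \<Rightarrow>\<^sub>0 'k)" and
  forest_diamond :: "'k \<Rightarrow> 'x adforest \<Rightarrow> 'x adforest \<Rightarrow> ('x adforest \<Rightarrow>\<^sub>0 'k)" where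
  "tree_diamond lam Bullet T' = Poly_Mapping.single T' 1"
| "tree_diamond lam T Bullet = Poly_Mapping.single T 1"
| "tree_diamond lam (Bplus A) (Bplus A') =
    linear_ext Bplus (forest_diamond lam (Tree (Bplus A)) A')
    + linear_ext Bplus (forest_diamond lam A (Tree (Bplus A')))
    + scale lam (linear_ext Bplus (forest_diamond lam A A'))"
| "forest_diamond lam (Tree T) (Tree T') = linear_ext Tree (tree_diamond lam T T')"
| "forest_diamond lam (Tree T) (Angle T' y G) =
    linear_ext (\<lambda>U. Angle U y G) (tree_diamond lam T T')"
| "forest_diamond lam (Angle T x F) G = linear_ext (Angle T x) (forest_diamond lam F G)"
  by pat_completeness auto
termination
  by (relation "measure (case_sum (\<lambda>(_, T, T'). tree_weight T + tree_weight T')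
    (\<lambda>(_, F, G). forest_weight F + forest_weight G))") auto

definition ADF :: "'k :: field_char_0 \<Rightarrow> ('x, 'k, 'x adforest \<Rightarrow>\<^sub>0 'k) rota_baxter_data" where
  "ADF lam = \<lparr>
    obj = (\<lambda>X. free_space (decorated_forests X)),
    arr = (\<lambda>X \<sigma>. linear_ext (map_adforest \<sigma>)),
    tprod = (\<lambda>X Y. bilinear_ext (forest_diamond lam)),
    tunit = Poly_Mapping.single (Tree Bullet) 1,
    rb_op = (\<lambda>X. linear_ext (\<lambda>F. Tree (Bplus F)))\<rparr>"

definition bullet_angle_bullet :: "'x \<Rightarrow> 'x adforest" where
  "bullet_angle_bullet x = Angle Bullet x (Tree Bullet)"

definition O_species :: "('x, 'k :: field_char_0, 'x adforest \<Rightarrow>\<^sub>0 'k) species_data" where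
  "O_species = \<lparr>
    obj = (\<lambda>X. free_space {bullet_angle_bullet x | x. X = {x}}),
    arr = (\<lambda>X \<sigma>. linear_ext (map_adforest \<sigma>))\<rparr>"

definition incl :: "'x set \<Rightarrow> ('x adforest \<Rightarrow>\<^sub>0 'k :: field_char_0) \<Rightarrow> ('x adforest \<Rightarrow>\<^sub>0 'k)" where
  "incl X p = (if is_singleton X then p else 0)"

end

theory Submission
  imports Defs
begin

text \<open>
  Write \<open>F x G\<close> for the forest obtained by joining two forests at an angle decorated by \<open>x\<close>.  The
  product satisfies \<open>(F x G) \<diamond> H = F x (G \<diamond> H)\<close> and \<open>F \<diamond> (G x H) = (F \<diamond> G) x H\<close>, so both
  associativity and the compatibility of a map with \<open>\<diamond>\<close> reduce to trees \<open>B\<^sup>+(F)\<close>, where the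
  Rota--Baxter identity lowers the weight.  Since \<open>T x F = T \<diamond> (\<bullet> x \<bullet>) \<diamond> F\<close>, a morphism of
  Rota--Baxter species out of the forests is forced by its values on the generators \<open>\<bullet> x \<bullet>\<close>; this
  prescription, taken as a recursive definition on basis forests, is multiplicative by induction.
\<close>

section \<open>Linear maps between spaces of finitely supported functions\<close>

text \<open>Two kinds of linear algebra meet here. On the forest side all vectors live in one type,
  and the product ignores the sets \<open>X\<close> and \<open>Y\<close>: its laws are proved for
  arbitrary forests, repeated decorations included, and the grading enters only through the supports
  of vectors. On the side of a target \<open>Q\<close> each space has its own carrier and
  operations, and every operation has to be told its index sets. The value of a basis forest
  therefore reads these sets off the angles and is controlled only when the decorations are
  distinct; identities in \<open>Q\<close> are checked on basis vectors through maps that are linear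
  on carriers. The inductions run on a total weight because the Rota--Baxter identity strips a root
  sometimes from the left factor, sometimes from the right one, and keeps the other factor whole; no
  structural induction on a single factor follows this.\<close>

abbreviation basis_vec :: "'a \<Rightarrow> ('a \<Rightarrow>\<^sub>0 'k :: field)" where
  "basis_vec a \<equiv> Poly_Mapping.single a 1"

lemma lookup_scale [simp]: "Poly_Mapping.lookup (scale c p) a = c * Poly_Mapping.lookup p a"
  unfolding scale_def by (simp add: Poly_Mapping.map.rep_eq when_def)

lemma scale_add: "scale c (p + q) = scale c p + scale c q"
  by (rule poly_mapping_eqI) (simp add: lookup_add algebra_simps)

lemma scale_left_add: "scale (c + d) p = scale c p + scale d p"
  by (rule poly_mapping_eqI) (simp add: lookup_add algebra_simps)

lemma scale_scale [simp]: "scale c (scale d p) = scale (c * d) p"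
  by (rule poly_mapping_eqI) (simp add: algebra_simps)

lemma scale_one [simp]: "scale 1 p = p"
  by (rule poly_mapping_eqI) simp

lemma scale_zero [simp]: "scale c 0 = 0" "scale 0 p = 0"
  by (rule poly_mapping_eqI, simp)+

lemma scale_single [simp]: "scale c (Poly_Mapping.single a d) = Poly_Mapping.single a (c * d)"
  by (rule poly_mapping_eqI) (simp add: lookup_single when_def)

lemma keys_scale: "Poly_Mapping.keys (scale c p) \<subseteq> Poly_Mapping.keys p"
  by (auto simp: in_keys_iff)

text \<open>Linearity on the whole type, without carriers. The operations on forests are total, so
  their identities can be checked on basis vectors with no side conditions.\<close>

definition lin :: "(('a \<Rightarrow>\<^sub>0 'k :: field) \<Rightarrow> ('b \<Rightarrow>\<^sub>0 'k)) \<Rightarrow> bool" where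
  "lin L \<longleftrightarrow> (\<forall>p q. L (p + q) = L p + L q) \<and> (\<forall>c p. L (scale c p) = scale c (L p))"

lemma lin_add: "lin L \<Longrightarrow> L (p + q) = L p + L q"
  and lin_scale: "lin L \<Longrightarrow> L (scale c p) = scale c (L p)"
  by (simp_all add: lin_def)

lemma lin_zero: "lin L \<Longrightarrow> L 0 = 0"
  using lin_scale[of L 0 0] by simp

lemma lin_sum: "lin L \<Longrightarrow> L (\<Sum>i\<in>I. f i) = (\<Sum>i\<in>I. L (f i))"
  by (induction I rule: infinite_finite_induct) (auto simp: lin_zero lin_add)

lemma sum_basis_vec:
  "(\<Sum>a\<in>Poly_Mapping.keys p. scale (Poly_Mapping.lookup p a) (basis_vec a)) = p"
proof (rule poly_mapping_eqI)
  fix b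
  show "Poly_Mapping.lookup
      (\<Sum>a\<in>Poly_Mapping.keys p. scale (Poly_Mapping.lookup p a) (basis_vec a)) b
    = Poly_Mapping.lookup p b"
    by (simp add: lookup_sum lookup_single when_def if_distrib sum.delta in_keys_iff cong: if_cong)
qed

lemma lin_eqI:
  assumes "lin L" "lin M" "\<And>a. a \<in> Poly_Mapping.keys p \<Longrightarrow> L (basis_vec a) = M (basis_vec a)"
  shows "L p = M p"
proof -
  have "L (\<Sum>a\<in>Poly_Mapping.keys p. scale (Poly_Mapping.lookup p a) (basis_vec a))
      = M (\<Sum>a\<in>Poly_Mapping.keys p. scale (Poly_Mapping.lookup p a) (basis_vec a))"
    unfolding lin_sum[OF assms(1)] lin_sum[OF assms(2)] lin_scale[OF assms(1)] lin_scale[OF assms(2)]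
    using assms(3) by (intro sum.cong) auto
  then show ?thesis by (simp only: sum_basis_vec)
qed

lemma bilin_eqI:
  assumes "\<And>q. lin (\<lambda>p. L p q)" "\<And>q. lin (\<lambda>p. M p q)"
    and "\<And>p. lin (L p)" "\<And>p. lin (M p)"
    and "\<And>a b. L (basis_vec a) (basis_vec b) = M (basis_vec a) (basis_vec b)"
  shows "L p q = M p q"
proof (rule lin_eqI[of "\<lambda>p. L p q" "\<lambda>p. M p q" p])
  fix a
  show "L (basis_vec a) q = M (basis_vec a) q"
    by (rule lin_eqI[OF assms(3,4,5)])
qed (rule assms(1,2))+

lemma trilin_eqI:
  assumes "\<And>q r. lin (\<lambda>p. L p q r)" "\<And>q r. lin (\<lambda>p. M p q r)"
    and "\<And>p r. lin (\<lambda>q. L p q r)" "\<And>p r. lin (\<lambda>q. M p q r)"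
    and "\<And>p q. lin (L p q)" "\<And>p q. lin (M p q)"
    and "\<And>a b c. L (basis_vec a) (basis_vec b) (basis_vec c)
      = M (basis_vec a) (basis_vec b) (basis_vec c)"
  shows "L p q r = M p q r"
proof (rule lin_eqI[of "\<lambda>p. L p q r" "\<lambda>p. M p q r" p])
  fix a
  show "L (basis_vec a) q r = M (basis_vec a) q r"
    by (rule bilin_eqI[OF assms(3-7)])
qed (rule assms(1,2))+

text \<open>The common source of linearity for \<open>linear_ext\<close> and, in each argument, for
  \<open>bilinear_ext\<close>.\<close>

lemma lin_combination:
  fixes h :: "'a \<Rightarrow> 'c \<Rightarrow>\<^sub>0 'b :: field"
  shows "lin (\<lambda>p. \<Sum>a\<in>Poly_Mapping.keys p. scale (Poly_Mapping.lookup p a) (h a))"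
proof -
  \<comment> \<open>The index set \<open>keys p\<close> varies with \<open>p\<close>, so additivity
    is not termwise. Over a common finite superset the extra terms have coefficient zero.\<close>
  have extend: "(\<Sum>a\<in>Poly_Mapping.keys p. scale (Poly_Mapping.lookup p a) (h a))
      = (\<Sum>a\<in>S. scale (Poly_Mapping.lookup p a) (h a))"
    if "finite S" "Poly_Mapping.keys p \<subseteq> S" for p :: "'a \<Rightarrow>\<^sub>0 'b" and S
    using that by (intro sum.mono_neutral_left) (auto simp: in_keys_iff)
  show ?thesis
    unfolding lin_def
  proof (intro conjI allI)
    fix p q :: "'a \<Rightarrow>\<^sub>0 'b"
    let ?S = "Poly_Mapping.keys p \<union> Poly_Mapping.keys q"
    show "(\<Sum>a\<in>Poly_Mapping.keys (p + q). scale (Poly_Mapping.lookup (p + q) a) (h a))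
      = (\<Sum>a\<in>Poly_Mapping.keys p. scale (Poly_Mapping.lookup p a) (h a))
      + (\<Sum>a\<in>Poly_Mapping.keys q. scale (Poly_Mapping.lookup q a) (h a))"
      using extend[of ?S p] extend[of ?S q] extend[of ?S "p + q"] keys_add[of p q]
      by (simp add: lookup_add scale_left_add sum.distrib)
  next
    fix c and p :: "'a \<Rightarrow>\<^sub>0 'b"
    have "(\<Sum>a\<in>Poly_Mapping.keys p. scale c (scale (Poly_Mapping.lookup p a) (h a)))
      = scale c (\<Sum>a\<in>Poly_Mapping.keys p. scale (Poly_Mapping.lookup p a) (h a))"
      by (rule lin_sum[symmetric]) (simp add: lin_def scale_add mult.commute)
    then show "(\<Sum>a\<in>Poly_Mapping.keys (scale c p). scale (Poly_Mapping.lookup (scale c p) a) (h a))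
      = scale c (\<Sum>a\<in>Poly_Mapping.keys p. scale (Poly_Mapping.lookup p a) (h a))"
      using extend[of "Poly_Mapping.keys p" "scale c p"] keys_scale[of c p] by simp
  qed
qed

lemma lin_compose: "lin L \<Longrightarrow> lin M \<Longrightarrow> lin (\<lambda>p. L (M p))"
  by (simp add: lin_def)

lemma lin_ident [intro!, simp]: "lin (\<lambda>p. p)"
  and lin_plus [intro!]: "lin L \<Longrightarrow> lin M \<Longrightarrow> lin (\<lambda>p. L p + M p)"
  and lin_scaled [intro!]: "lin L \<Longrightarrow> lin (\<lambda>p. scale c (L p))"
  by (simp_all add: lin_def scale_add ac_simps)

lemma linear_ext_combination:
  "linear_ext h p = (\<Sum>a\<in>Poly_Mapping.keys p. scale (Poly_Mapping.lookup p a) (basis_vec (h a)))"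
  by (simp add: linear_ext_def)

lemma lin_linear_ext [intro!]: "lin L \<Longrightarrow> lin (\<lambda>p. linear_ext h (L p))"
  using lin_compose[OF lin_combination] by (simp only: linear_ext_combination)

lemma linear_ext_single [simp]:
  "linear_ext h (Poly_Mapping.single a c) = Poly_Mapping.single (h a) c"
  by (simp add: linear_ext_def)

lemma linear_ext_add: "linear_ext h (p + q) = linear_ext h p + linear_ext h q"
  and linear_ext_scale: "linear_ext h (scale c p) = scale c (linear_ext h p)"
  by (rule lin_add lin_scale, rule lin_linear_ext, rule lin_ident)+

lemma linear_ext_linear_ext: "linear_ext f (linear_ext h p) = linear_ext (\<lambda>a. f (h a)) p"
  by (rule lin_eqI[where p = p]) auto

lemma keys_linear_ext: "Poly_Mapping.keys (linear_ext h p) \<subseteq> h ` Poly_Mapping.keys p"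
  unfolding linear_ext_def by (rule order.trans[OF keys_sum]) (auto split: if_splits)

lemma bilinear_ext_combination_left:
  fixes h :: "'a \<Rightarrow> 'b \<Rightarrow> ('c \<Rightarrow>\<^sub>0 'k :: field)"
  shows "bilinear_ext h p q = (\<Sum>a\<in>Poly_Mapping.keys p. scale (Poly_Mapping.lookup p a)
    (\<Sum>b\<in>Poly_Mapping.keys q. scale (Poly_Mapping.lookup q b) (h a b)))"
proof -
  have "scale c (\<Sum>b\<in>S. f b) = (\<Sum>b\<in>S. scale c (f b))" for c and S and f :: "'b \<Rightarrow> 'c \<Rightarrow>\<^sub>0 'k"
    by (rule lin_sum) (rule lin_scaled[OF lin_ident])
  then show ?thesis by (simp add: bilinear_ext_def)
qed

text \<open>Transfers linearity in the left argument to the right one.\<close>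

lemma bilinear_ext_flip: "bilinear_ext h p q = bilinear_ext (\<lambda>b a. h a b) q p"
  unfolding bilinear_ext_def by (subst sum.swap) (simp add: mult.commute)

lemma lin_bilinear_ext_left [intro!]: "lin L \<Longrightarrow> lin (\<lambda>p. bilinear_ext h (L p) q)"
  using lin_compose[OF lin_combination] by (simp only: bilinear_ext_combination_left)

lemma lin_bilinear_ext_right [intro!]: "lin L \<Longrightarrow> lin (\<lambda>q. bilinear_ext h p (L q))"
  using lin_bilinear_ext_left by (subst bilinear_ext_flip)

lemma bilinear_ext_single [simp]: "bilinear_ext h (basis_vec a) (basis_vec b) = h a b"
  by (simp add: bilinear_ext_def)

lemma bilinear_ext_add:
  "bilinear_ext h (p + p') q = bilinear_ext h p q + bilinear_ext h p' q"
  "bilinear_ext h p (q + q') = bilinear_ext h p q + bilinear_ext h p q'"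
  and bilinear_ext_scale:
  "bilinear_ext h (scale c p) q = scale c (bilinear_ext h p q)"
  "bilinear_ext h p (scale c q) = scale c (bilinear_ext h p q)"
  by ((rule lin_add[of "\<lambda>p. bilinear_ext h p q"] lin_scale[of "\<lambda>p. bilinear_ext h p q"]
        lin_add[of "bilinear_ext h p"] lin_scale[of "bilinear_ext h p"]),
      (rule lin_bilinear_ext_left lin_bilinear_ext_right), rule lin_ident)+

lemma keys_bilinear_ext:
  "Poly_Mapping.keys (bilinear_ext h p q)
    \<subseteq> (\<Union>a\<in>Poly_Mapping.keys p. \<Union>b\<in>Poly_Mapping.keys q. Poly_Mapping.keys (h a b))"
  unfolding bilinear_ext_def
  by (intro order.trans[OF keys_sum] UN_mono order_refl keys_scale)

section \<open>The product of angularly decorated forests\<close>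

text \<open>\<open>Angle\<close> only puts a single tree to the left of a decoration. Multiplying
  \<open>T y G\<close> on the left by a forest leaves a whole forest to the left of
  \<open>y\<close>, which calls for this general form.\<close>

primrec join_forests :: "'x adforest \<Rightarrow> 'x \<Rightarrow> 'x adforest \<Rightarrow> 'x adforest" where
  "join_forests (Tree T) z G = Angle T z G"
| "join_forests (Angle T x F) z G = Angle T x (join_forests F z G)"

definition diamond :: "'k :: field \<Rightarrow> ('x adforest \<Rightarrow>\<^sub>0 'k) \<Rightarrow> ('x adforest \<Rightarrow>\<^sub>0 'k)
    \<Rightarrow> ('x adforest \<Rightarrow>\<^sub>0 'k)" where
  "diamond lam = bilinear_ext (forest_diamond lam)"

definition join :: "('x adforest \<Rightarrow>\<^sub>0 'k) \<Rightarrow> 'x \<Rightarrow> ('x adforest \<Rightarrow>\<^sub>0 'k :: field)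
    \<Rightarrow> ('x adforest \<Rightarrow>\<^sub>0 'k)" where
  "join p x q = bilinear_ext (\<lambda>F G. basis_vec (join_forests F x G)) p q"

definition graft :: "('x adforest \<Rightarrow>\<^sub>0 'k :: field) \<Rightarrow> ('x adforest \<Rightarrow>\<^sub>0 'k)" where
  "graft = linear_ext (\<lambda>F. Tree (Bplus F))"

lemma lin_diamond_left [intro!]: "lin L \<Longrightarrow> lin (\<lambda>p. diamond lam (L p) q)"
  and lin_diamond_right [intro!]: "lin L \<Longrightarrow> lin (\<lambda>p. diamond lam q (L p))"
  and lin_join_left [intro!]: "lin L \<Longrightarrow> lin (\<lambda>p. join (L p) x q)"
  and lin_join_right [intro!]: "lin L \<Longrightarrow> lin (\<lambda>p. join q x (L p))"
  and lin_graft [intro!]: "lin L \<Longrightarrow> lin (\<lambda>p. graft (L p))"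
  unfolding diamond_def join_def graft_def
  by (rule lin_bilinear_ext_left lin_bilinear_ext_right lin_linear_ext; assumption)+

lemma diamond_basis [simp]: "diamond lam (basis_vec F) (basis_vec G) = forest_diamond lam F G"
  and join_basis [simp]: "join (basis_vec F) x (basis_vec G) = basis_vec (join_forests F x G)"
  and graft_basis [simp]: "graft (basis_vec F) = basis_vec (Tree (Bplus F))"
  by (simp_all add: diamond_def join_def graft_def)

lemma join_basis_left: "join (basis_vec F) x q = linear_ext (join_forests F x) q"
  and join_basis_right: "join p x (basis_vec G) = linear_ext (\<lambda>F. join_forests F x G) p"
  by (rule lin_eqI[where p = q] lin_eqI[where p = p]; auto)+

lemma diamond_add:
  "diamond lam (p + p') q = diamond lam p q + diamond lam p' q"
  "diamond lam p (q + q') = diamond lam p q + diamond lam p q'"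
  and diamond_scale:
  "diamond lam (scale c p) q = scale c (diamond lam p q)"
  "diamond lam p (scale c q) = scale c (diamond lam p q)"
  by (simp_all add: diamond_def bilinear_ext_add bilinear_ext_scale)

lemma tree_diamond_Bullet_right [simp]: "tree_diamond lam T Bullet = basis_vec T"
  by (cases T) auto

lemma forest_diamond_unit_left: "forest_diamond lam (Tree Bullet) G = basis_vec G"
  by (cases G) auto

lemma forest_diamond_unit_right: "forest_diamond lam F (Tree Bullet) = basis_vec F"
  by (induction F rule: adforest.induct[of "\<lambda>_. True"]) auto

lemma diamond_unit_left: "diamond lam (basis_vec (Tree Bullet)) p = p"
  by (rule lin_eqI[where p = p]) (auto simp: forest_diamond_unit_left)

lemma diamond_unit_right: "diamond lam p (basis_vec (Tree Bullet)) = p"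
  by (rule lin_eqI[where p = p]) (auto simp: forest_diamond_unit_right)

lemma forest_diamond_join_left:
  "forest_diamond lam (join_forests F x G) H = linear_ext (join_forests F x) (forest_diamond lam G H)"
  by (induction F rule: adforest.induct[of "\<lambda>_. True"]) (auto simp: linear_ext_linear_ext)

text \<open>Only the last tree of \<open>F\<close> and the first tree of \<open>G\<close> interact,
  so the angle to the right of \<open>G\<close> is untouched. The defining equations recurse on the
  left factor only, hence the induction on \<open>F\<close>.\<close>

lemma forest_diamond_join_right:
  "forest_diamond lam F (join_forests G x H)
    = linear_ext (\<lambda>K. join_forests K x H) (forest_diamond lam F G)"
proof (induction F rule: adforest.induct[of "\<lambda>_. True"])
  case (Tree T)
  then show ?case by (cases G) (auto simp: linear_ext_linear_ext)
qed (auto simp: linear_ext_linear_ext)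

lemma diamond_join_left: "diamond lam (join p x q) r = join p x (diamond lam q r)"
  by (rule trilin_eqI[where L = "\<lambda>p q r. diamond lam (join p x q) r"
        and M = "\<lambda>p q r. join p x (diamond lam q r)"])
    (auto simp: forest_diamond_join_left join_basis_left)

lemma diamond_join_right: "diamond lam p (join q x r) = join (diamond lam p q) x r"
  by (rule trilin_eqI[where L = "\<lambda>p q r. diamond lam p (join q x r)"
        and M = "\<lambda>p q r. join (diamond lam p q) x r"])
    (auto simp: forest_diamond_join_right join_basis_right)

lemma diamond_graft:
  "diamond lam (graft p) (graft q)
    = graft (diamond lam (graft p) q + diamond lam p (graft q) + scale lam (diamond lam p q))"
proof (rule bilin_eqI[where L = "\<lambda>p q. diamond lam (graft p) (graft q)"])
  fix F G :: "'a adforest"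
  show "diamond lam (graft (basis_vec F)) (graft (basis_vec G))
    = graft (diamond lam (graft (basis_vec F)) (basis_vec G)
      + diamond lam (basis_vec F) (graft (basis_vec G))
      + scale lam (diamond lam (basis_vec F) (basis_vec G)))"
    by (simp add: graft_def linear_ext_add linear_ext_scale linear_ext_linear_ext)
qed auto

section \<open>Associativity of the product\<close>

lemma diamond_assoc_graft:
  fixes p q r :: "'x adforest \<Rightarrow>\<^sub>0 'k :: field" and lam :: 'k
  defines "assoc \<equiv> \<lambda>a b c. diamond lam (diamond lam a b) c = diamond lam a (diamond lam b c)"
  assumes "assoc (graft p) (graft q) r" "assoc (graft p) q (graft r)" "assoc p (graft q) (graft r)"
    and "assoc (graft p) q r" "assoc p (graft q) r" "assoc p q (graft r)" "assoc p q r"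
  shows "assoc (graft p) (graft q) (graft r)"
proof -
  let ?P = "diamond lam (graft p) q + diamond lam p (graft q) + scale lam (diamond lam p q)"
  let ?Q = "diamond lam (graft q) r + diamond lam q (graft r) + scale lam (diamond lam q r)"
  \<comment> \<open>The product of \<open>graft p\<close> and \<open>graft q\<close> is
    \<open>graft ?P\<close>. In the first summand it stays folded, so that the first hypothesis
    applies to it directly.\<close>
  have "diamond lam (diamond lam (graft p) (graft q)) (graft r)
      = graft (diamond lam (diamond lam (graft p) (graft q)) r + diamond lam ?P (graft r)
        + scale lam (diamond lam ?P r))"
    by (simp only: diamond_graft[of lam p q] diamond_graft[of lam ?P r])
  \<comment> \<open>By bilinearity each side has seven terms, with coefficients 1,
    \<open>lam\<close> or \<open>lam * lam\<close>, and the seven hypotheses match them one to one.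
    In each hypothesis at least one of the three outer roots is gone.\<close>
  also have "\<dots> = graft (diamond lam (graft p) ?Q + diamond lam p (diamond lam (graft q) (graft r))
        + scale lam (diamond lam p ?Q))"
    using assms(2-) unfolding assoc_def
    by (simp add: diamond_add diamond_scale scale_add algebra_simps)
  also have "\<dots> = diamond lam (graft p) (diamond lam (graft q) (graft r))"
    by (simp only: diamond_graft[of lam q r] diamond_graft[of lam p ?Q])
  finally show ?thesis unfolding assoc_def .
qed

lemma basis_Angle: "basis_vec (Angle T x F) = join (basis_vec (Tree T)) x (basis_vec F)"
  by simp

text \<open>Makes the passage from \<open>Angle T y G\<close> to \<open>Tree T\<close> a strict
  decrease of weight.\<close>

lemma forest_weight_pos: "forest_weight F > 0"
  by (cases F) auto

lemma diamond_assoc_basis: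
  fixes F G H :: "'x adforest" and lam :: "'k :: field"
  defines "assoc \<equiv> \<lambda>F G H. diamond lam (diamond lam (basis_vec F) (basis_vec G)) (basis_vec H)
    = diamond lam (basis_vec F) (diamond lam (basis_vec G) (basis_vec H))"
  shows "assoc F G H"
proof (induction "forest_weight F + forest_weight G + forest_weight H"
    arbitrary: F G H rule: less_induct)
  case less
  show ?case
  proof (cases F)
    case (Angle T x F')
    then have "assoc F' G H" by (intro less) auto
    then show ?thesis
      unfolding assoc_def Angle basis_Angle diamond_join_left by simp
  next
    case F: (Tree T)
    show ?thesis
    proof (cases G)
      \<comment> \<open>An angle in the middle factor separates the two products: both bracketings
        are the join at \<open>y\<close> of \<open>F \<diamond> T'\<close> and
        \<open>G' \<diamond> H\<close>, with no appeal to the induction hypothesis.\<close>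
      case (Angle T' y G')
      show ?thesis
        unfolding assoc_def Angle basis_Angle diamond_join_left diamond_join_right ..
    next
      case G: (Tree T')
      show ?thesis
      proof (cases H)
        case (Angle T'' z H')
        then have "assoc F G (Tree T'')" using forest_weight_pos[of H'] by (intro less) auto
        then show ?thesis
          unfolding assoc_def Angle basis_Angle diamond_join_right by simp
      next
        case H: (Tree T'')
        show ?thesis
        proof (cases "T = Bullet \<or> T' = Bullet \<or> T'' = Bullet")
          case True
          then show ?thesis
            unfolding assoc_def F G H by (auto simp only: diamond_unit_left diamond_unit_right)
        next
          case False
          then obtain A A' A'' where A: "T = Bplus A" "T' = Bplus A'" "T'' = Bplus A''"
            by (meson adtree.exhaust)
          have smaller: "assoc F G A''" "assoc F A' H" "assoc A G H" "assoc F A' A''" "assoc A G A''"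
            "assoc A A' H" "assoc A A' A''"
            by (rule less; simp add: F G H A)+
          then show ?thesis
            unfolding assoc_def F G H A graft_basis[symmetric] by (rule diamond_assoc_graft)
        qed
      qed
    qed
  qed
qed

lemma diamond_assoc: "diamond lam (diamond lam p q) r = diamond lam p (diamond lam q r)"
  by (rule trilin_eqI[where L = "\<lambda>p q r. diamond lam (diamond lam p q) r"
        and M = "\<lambda>p q r. diamond lam p (diamond lam q r)"])
    (rule diamond_assoc_basis | force)+

text \<open>The recursion pattern of the product as an induction rule. In the last case
  \<open>F\<close> is an arbitrary forest and only the first tree \<open>T\<close> of the right
  factor survives, because the product of \<open>F\<close> with \<open>T y G\<close> never looks
  beyond \<open>y\<close>.\<close>

lemma forest_pair_induct [case_names unit_left unit_right graft angle_left angle_right]: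
  fixes F G :: "'x adforest"
  assumes "\<And>G. P (Tree Bullet) G" "\<And>F. P F (Tree Bullet)"
    and "\<And>F G. P (Tree (Bplus F)) G \<Longrightarrow> P F (Tree (Bplus G)) \<Longrightarrow> P F G
      \<Longrightarrow> P (Tree (Bplus F)) (Tree (Bplus G))"
    and "\<And>T x F G. P F G \<Longrightarrow> P (Angle T x F) G"
    and "\<And>F T y G. P F (Tree T) \<Longrightarrow> P F (Angle T y G)"
  shows "P F G"
proof (induction "forest_weight F + forest_weight G" arbitrary: F G rule: less_induct)
  case less
  show ?case
  proof (cases F)
    case (Angle T x F')
    then show ?thesis using less by (auto intro: assms(4))
  next
    case F: (Tree T)
    show ?thesis
    proof (cases G)
      case (Angle T' y G')
      then show ?thesis
        using less forest_weight_pos[of G'] by (auto intro: assms(5))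
    next
      case G: (Tree T')
      show ?thesis
      proof (cases "T = Bullet \<or> T' = Bullet")
        case True
        then show ?thesis using F G assms(1,2) by auto
      next
        case False
        then obtain A A' where A: "T = Bplus A" "T' = Bplus A'" by (meson adtree.exhaust)
        have "P F A'" "P A G" "P A A'" by (rule less; simp add: F G A)+
        then show ?thesis unfolding F G A by (rule assms(3))
      qed
    qed
  qed
qed

section \<open>Decorations and relabelling in products\<close>

lemma forest_diamond_graft:
  "forest_diamond lam (Tree (Bplus F)) (Tree (Bplus G))
    = graft (forest_diamond lam (Tree (Bplus F)) G + forest_diamond lam F (Tree (Bplus G))
      + scale lam (forest_diamond lam F G))"
  using diamond_graft[of lam "basis_vec F" "basis_vec G"] by simp

lemma forest_diamond_Angle_right:
  "forest_diamond lam F (Angle T y G)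
    = linear_ext (\<lambda>K. join_forests K y G) (forest_diamond lam F (Tree T))"
  using forest_diamond_join_right[of lam F "Tree T" y G] by simp

declare tree_diamond.simps [simp del] forest_diamond.simps [simp del]

lemma forest_angles_join [simp]:
  "forest_angles (join_forests F x G) = forest_angles F @ x # forest_angles G"
  by (induction F rule: adforest.induct[of "\<lambda>_. True"]) auto

text \<open>Multiplying fuses two trees and adds roots; it neither creates, deletes nor permutes
  angles. The concatenated list gives both the set of decorations and, for disjoint sets, their
  distinctness.\<close>

lemma keys_forest_diamond:
  "Poly_Mapping.keys (forest_diamond lam F G)
    \<subseteq> {K. forest_angles K = forest_angles F @ forest_angles G}"
proof (induction F G rule: forest_pair_induct)
  case (unit_left G)
  then show ?case by (simp add: forest_diamond_unit_left)
next
  case (unit_right F)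
  then show ?case by (simp add: forest_diamond_unit_right)
next
  case (graft F G)
  have "Poly_Mapping.keys (forest_diamond lam (Tree (Bplus F)) G
      + forest_diamond lam F (Tree (Bplus G)) + scale lam (forest_diamond lam F G))
    \<subseteq> {K. forest_angles K = forest_angles F @ forest_angles G}"
    using graft by (intro order.trans[OF keys_add] Un_least order.trans[OF keys_scale]) simp_all
  then show ?case
    unfolding forest_diamond_graft graft_def by (intro order.trans[OF keys_linear_ext]) auto
next
  case (angle_left T x F G)
  then show ?case
    unfolding forest_diamond.simps by (intro order.trans[OF keys_linear_ext]) auto
next
  case (angle_right F T y G)
  then show ?case
    unfolding forest_diamond_Angle_right by (intro order.trans[OF keys_linear_ext]) auto
qed

lemma map_adforest_join [simp]:
  "map_adforest \<sigma> (join_forests F x G) = join_forests (map_adforest \<sigma> F) (\<sigma> x) (map_adforest \<sigma> G)"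
  by (induction F rule: adforest.induct[of "\<lambda>_. True"]) auto

lemma map_graft: "linear_ext (map_adforest \<sigma>) (graft p) = graft (linear_ext (map_adforest \<sigma>) p)"
  by (simp add: graft_def linear_ext_linear_ext)

text \<open>The product never compares decorations, so this holds for every function \<sigma>,
  injective or not.\<close>

lemma map_forest_diamond:
  "linear_ext (map_adforest \<sigma>) (forest_diamond lam F G)
    = forest_diamond lam (map_adforest \<sigma> F) (map_adforest \<sigma> G)"
proof (induction F G rule: forest_pair_induct)
  case (unit_left G)
  then show ?case by (simp add: forest_diamond_unit_left)
next
  case (unit_right F)
  then show ?case by (simp add: forest_diamond_unit_right)
next
  case (graft F G)
  show ?case
    using graft by (simp add: forest_diamond_graft map_graft linear_ext_add linear_ext_scale)
next
  case (angle_left T x F G)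
  show ?case
    by (simp add: forest_diamond.simps linear_ext_linear_ext flip: angle_left)
next
  case (angle_right F T y G)
  show ?case
    using angle_right[symmetric] by (simp add: forest_diamond_Angle_right linear_ext_linear_ext)
qed

lemma map_diamond:
  "linear_ext (map_adforest \<sigma>) (diamond lam p q)
    = diamond lam (linear_ext (map_adforest \<sigma>) p) (linear_ext (map_adforest \<sigma>) q)"
  by (rule bilin_eqI[where L = "\<lambda>p q. linear_ext (map_adforest \<sigma>) (diamond lam p q)"])
    (auto simp: map_forest_diamond)

section \<open>The species of angularly decorated forests\<close>

lemma linear_map_class_ring_iff:
  fixes V :: "('k :: field, 'v, 'z) module_scheme" and W :: "('k, 'w, 'y) module_scheme"
  shows "linear_map class_ring V W f \<longleftrightarrow> vectorspace class_ring V \<and> vectorspace class_ring W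
    \<and> (\<forall>v \<in> carrier V. f v \<in> carrier W)
    \<and> (\<forall>u \<in> carrier V. \<forall>v \<in> carrier V. f (u \<oplus>\<^bsub>V\<^esub> v) = f u \<oplus>\<^bsub>W\<^esub> f v)
    \<and> (\<forall>c. \<forall>v \<in> carrier V. f (c \<odot>\<^bsub>V\<^esub> v) = c \<odot>\<^bsub>W\<^esub> f v)"
  unfolding linear_map_def mod_hom_def mod_hom_axioms_def LinearCombinations.module_hom_def vectorspace_def
  by auto

lemma linear_map_compose:
  fixes V :: "('k :: field, 'v, 'z) module_scheme"
  assumes "linear_map class_ring U V f" "linear_map class_ring V W g"
  shows "linear_map class_ring U W (\<lambda>v. g (f v))"
  using assms by (simp add: linear_map_class_ring_iff)

lemma free_space_sel [simp]:
  "carrier (free_space B) = {p. Poly_Mapping.keys p \<subseteq> B}"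
  "zero (free_space B) = 0" "add (free_space B) = (+)" "smult (free_space B) = scale"
  by (simp_all add: free_space_def)

lemma keys_scale_subset: "Poly_Mapping.keys p \<subseteq> B \<Longrightarrow> Poly_Mapping.keys (scale c p) \<subseteq> B"
  using keys_scale[of c p] by blast

lemma keys_add_subset:
  "Poly_Mapping.keys p \<subseteq> B \<Longrightarrow> Poly_Mapping.keys q \<subseteq> B \<Longrightarrow> Poly_Mapping.keys (p + q) \<subseteq> B"
  using keys_add[of p q] by blast

lemma vectorspace_free_space:
  "vectorspace class_ring (free_space B :: ('k :: field, 'a \<Rightarrow>\<^sub>0 'k) module)"
proof -
  have "\<exists>q. Poly_Mapping.keys q \<subseteq> B \<and> q + p = 0" if "Poly_Mapping.keys p \<subseteq> B"
    for p :: "'a \<Rightarrow>\<^sub>0 'k"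
    using that by (intro exI[of _ "- p"]) (auto simp: in_keys_iff)
  then have "abelian_group (free_space B :: ('k, 'a \<Rightarrow>\<^sub>0 'k) module)"
    by (intro abelian_groupI) (auto simp: keys_add_subset ac_simps)
  then have "Module.module class_ring (free_space B :: ('k, 'a \<Rightarrow>\<^sub>0 'k) module)"
    by (intro Module.module.intro Module.module_axioms.intro class_cring.cring_axioms)
      (simp_all add: keys_scale_subset scale_add scale_left_add)
  then show ?thesis
    by (intro vectorspace.intro class_field.field_axioms)
qed

lemma linear_map_free_spaceI:
  assumes "lin L" "\<And>p. Poly_Mapping.keys p \<subseteq> B \<Longrightarrow> Poly_Mapping.keys (L p) \<subseteq> C"
  shows "linear_map class_ring (free_space B) (free_space C) L"
  using assms by (simp add: linear_map_class_ring_iff vectorspace_free_space lin_def)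

lemma ADF_sel [simp]:
  "obj (ADF lam) X = free_space (decorated_forests X)"
  "arr (ADF lam) X \<sigma> = linear_ext (map_adforest \<sigma>)"
  "tprod (ADF lam) X Y = diamond lam"
  "tunit (ADF lam) = basis_vec (Tree Bullet)"
  "rb_op (ADF lam) X = graft"
  by (simp_all add: ADF_def diamond_def graft_def)

lemma O_species_sel [simp]:
  "obj O_species X = free_space {bullet_angle_bullet x | x. X = {x}}"
  "arr O_species X \<sigma> = linear_ext (map_adforest \<sigma>)"
  by (simp_all add: O_species_def)

section \<open>Relabelling and the species axioms\<close>

lemma angles_map [simp]:
  "tree_angles (map_adtree \<sigma> T) = map \<sigma> (tree_angles T)"
  "forest_angles (map_adforest \<sigma> F) = map \<sigma> (forest_angles F)"
  by (induction T and F) auto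

lemma set_ad_angles:
  fixes T :: "'x adtree" and F :: "'x adforest"
  shows "set_adtree T = set (tree_angles T)" "set_adforest F = set (forest_angles F)"
  by (induction T and F) auto

lemma map_decorated_forests:
  "F \<in> decorated_forests X \<Longrightarrow> bij_betw \<sigma> X Y \<Longrightarrow> map_adforest \<sigma> F \<in> decorated_forests Y"
  by (auto simp: decorated_forests_def bij_betw_def distinct_map)

lemma linear_ext_cong:
  "(\<And>a. a \<in> Poly_Mapping.keys p \<Longrightarrow> f a = g a) \<Longrightarrow> linear_ext f p = linear_ext g p"
  by (simp add: linear_ext_def)

lemma linear_ext_id [simp]: "linear_ext id p = p"
  by (rule lin_eqI[where p = p]) auto

lemma map_adforest_cong_set:
  "F \<in> decorated_forests X \<Longrightarrow> \<forall>x\<in>X. \<tau> x = \<sigma> x \<Longrightarrow> map_adforest \<tau> F = map_adforest \<sigma> F"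
  by (rule adforest.map_cong0) (auto simp: set_ad_angles decorated_forests_def)

lemma linear_map_relabel:
  assumes "\<And>F. F \<in> B \<Longrightarrow> map_adforest \<sigma> F \<in> C"
  shows "linear_map class_ring (free_space B) (free_space C) (linear_ext (map_adforest \<sigma>))"
proof (rule linear_map_free_spaceI)
  show "lin (linear_ext (map_adforest \<sigma>))" by (rule lin_linear_ext[OF lin_ident])
  show "Poly_Mapping.keys (linear_ext (map_adforest \<sigma>) p) \<subseteq> C" if "Poly_Mapping.keys p \<subseteq> B" for p
    using that assms by (intro order.trans[OF keys_linear_ext]) auto
qed

text \<open>The forest species and the species of generators are both spanned by decorated forests
  and relabelled in the same way, so the axioms are verified once. The third assumption yields
  \<open>arr_cong\<close>: a basis forest over \<open>X\<close> has no decorations outside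
  \<open>X\<close>.\<close>

lemma species_of_forests:
  assumes "\<And>X. obj P X = free_space (B X)"
    and "\<And>X \<sigma>. arr P X \<sigma> = linear_ext (map_adforest \<sigma>)"
    and "\<And>X. B X \<subseteq> decorated_forests X"
    and "\<And>X Y \<sigma> F. bij_betw \<sigma> X Y \<Longrightarrow> F \<in> B X \<Longrightarrow> map_adforest \<sigma> F \<in> B Y"
  shows "species P"
proof (rule species.intro)
  fix X Y :: "'a set" and \<sigma> \<tau> :: "'a \<Rightarrow> 'a" and v
  assume "bij_betw \<sigma> X Y" "\<forall>x\<in>X. \<tau> x = \<sigma> x" "v \<in> carrier (obj P X)"
  then show "arr P X \<tau> v = arr P X \<sigma> v"
    unfolding assms(1,2) using assms(3) by (intro linear_ext_cong map_adforest_cong_set[of _ X]) auto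
qed (simp_all add: assms vectorspace_free_space linear_map_relabel linear_ext_linear_ext
    adforest.map_id0 adforest.map_comp comp_def)

lemma species_ADF: "species (ADF lam)"
  by (rule species_of_forests) (auto intro: map_decorated_forests)

lemma species_O: "species O_species"
  by (rule species_of_forests)
    (auto simp: bullet_angle_bullet_def decorated_forests_def bij_betw_def)

lemma keys_graft:
  "Poly_Mapping.keys p \<subseteq> decorated_forests X \<Longrightarrow> Poly_Mapping.keys (graft p) \<subseteq> decorated_forests X"
  unfolding graft_def by (rule order.trans[OF keys_linear_ext]) (auto simp: decorated_forests_def)

lemma forest_diamond_decorated:
  assumes "F \<in> decorated_forests X" "G \<in> decorated_forests Y" "X \<inter> Y = {}"
  shows "Poly_Mapping.keys (forest_diamond lam F G) \<subseteq> decorated_forests (X \<union> Y)"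
  using assms by (intro order.trans[OF keys_forest_diamond]) (auto simp: decorated_forests_def)

lemma keys_diamond:
  assumes "Poly_Mapping.keys p \<subseteq> decorated_forests X" "Poly_Mapping.keys q \<subseteq> decorated_forests Y"
    and "X \<inter> Y = {}"
  shows "Poly_Mapping.keys (diamond lam p q) \<subseteq> decorated_forests (X \<union> Y)"
  unfolding diamond_def using assms
  by (intro order.trans[OF keys_bilinear_ext] UN_least forest_diamond_decorated) auto

text \<open>Disjointness matters only for the support of a product, that is, for landing in the
  right space. The equational axioms are the unrestricted identities of
  \<open>diamond\<close>.\<close>

lemma twisted_algebra_ADF: "twisted_algebra (ADF lam)"
proof (intro twisted_algebra.intro twisted_algebra_axioms.intro species_ADF)
  fix X Y :: "'a set" and a :: "'a adforest \<Rightarrow>\<^sub>0 'b"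
  assume disj: "X \<inter> Y = {}"
  show "linear_map class_ring (obj (ADF lam) Y) (obj (ADF lam) (X \<union> Y)) (tprod (ADF lam) X Y a)"
    if "a \<in> carrier (obj (ADF lam) X)"
    using that disj keys_diamond[of a X _ Y lam]
    by (simp add: linear_map_free_spaceI lin_diamond_right[OF lin_ident])
  show "linear_map class_ring (obj (ADF lam) X) (obj (ADF lam) (X \<union> Y))
      (\<lambda>b. tprod (ADF lam) X Y b a)"
    if "a \<in> carrier (obj (ADF lam) Y)"
    using that disj keys_diamond[of _ X a Y lam]
    by (simp add: linear_map_free_spaceI lin_diamond_left[OF lin_ident])
qed (simp_all add: map_diamond diamond_assoc diamond_unit_left diamond_unit_right
    decorated_forests_def)

lemma rota_baxter_species_ADF: "rota_baxter_species (ADF lam) lam"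
proof -
  have "species_morphism (ADF lam) (ADF lam) (rb_op (ADF lam))"
    by (intro species_morphism.intro species_morphism_axioms.intro species_ADF)
      (simp_all add: map_graft linear_map_free_spaceI lin_graft[OF lin_ident] keys_graft)
  then show ?thesis
    by (intro rota_baxter_species.intro rota_baxter_species_axioms.intro twisted_algebra_ADF)
      (simp_all add: diamond_graft)
qed

text \<open>For naturality of \<open>incl\<close>: its case distinction has to agree at both ends of
  an arrow.\<close>

lemma is_singleton_image_iff: "inj_on \<sigma> X \<Longrightarrow> is_singleton (\<sigma> ` X) \<longleftrightarrow> is_singleton X"
  by (simp add: is_singleton_altdef card_image)

lemma species_morphism_incl: "species_morphism O_species (ADF lam) incl"
proof (intro species_morphism.intro species_morphism_axioms.intro species_ADF species_O)
  fix X :: "'a set"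
  have "lin (incl X :: _ \<Rightarrow> _ \<Rightarrow>\<^sub>0 'b)"
    by (auto simp: lin_def incl_def)
  then show "linear_map class_ring (obj O_species X) (obj (ADF lam) X) (incl X)"
    by (auto intro!: linear_map_free_spaceI
        simp: incl_def bullet_angle_bullet_def decorated_forests_def split: if_splits)
next
  fix X Y :: "'a set" and \<sigma> and v :: "'a adforest \<Rightarrow>\<^sub>0 'b"
  assume "bij_betw \<sigma> X Y"
  then have "is_singleton Y \<longleftrightarrow> is_singleton X"
    using is_singleton_image_iff by (auto simp: bij_betw_def)
  then show "incl Y (arr O_species X \<sigma> v) = arr (ADF lam) X \<sigma> (incl X v)"
    by (simp add: incl_def linear_ext_def)
qed

section \<open>Linear maps out of a free space\<close>

text \<open>The linear map with prescribed values on the basis. Unlike in \<open>linear_ext\<close>,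
  the target is a space given by a record, so the sum is formed with the operations of
  \<open>V\<close>.\<close>

definition free_lift ::
    "('k, 'v, 'z) module_scheme \<Rightarrow> ('a \<Rightarrow> 'v) \<Rightarrow> ('a \<Rightarrow>\<^sub>0 'k :: field) \<Rightarrow> 'v" where
  "free_lift V \<phi> p =
    (\<Oplus>\<^bsub>V\<^esub>a\<in>Poly_Mapping.keys p. Poly_Mapping.lookup p a \<odot>\<^bsub>V\<^esub> \<phi> a)"

lemma linear_map_zero:
  fixes V :: "('k :: field, 'v, 'z) module_scheme"
  assumes "linear_map class_ring V W f"
  shows "f \<zero>\<^bsub>V\<^esub> = \<zero>\<^bsub>W\<^esub>"
  using assms mod_hom.f0_is_0 unfolding linear_map_def by blast

lemma linear_map_closed:
  fixes V :: "('k :: field, 'v, 'z) module_scheme"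
  shows "linear_map class_ring V W f \<Longrightarrow> v \<in> carrier V \<Longrightarrow> f v \<in> carrier W"
  by (simp add: linear_map_class_ring_iff)

text \<open>The counterpart of \<open>lin_eqI\<close> for maps whose linearity is known only on the
  carrier.\<close>

lemma free_space_eqI:
  fixes V :: "('k :: field, 'v, 'z) module_scheme"
  assumes f: "linear_map class_ring (free_space B) V f"
    and g: "linear_map class_ring (free_space B) V g"
    and eq: "\<And>a. a \<in> B \<Longrightarrow> f (basis_vec a) = g (basis_vec a)"
    and p: "Poly_Mapping.keys p \<subseteq> B"
  shows "f p = g p"
proof -
  let ?sum = "\<lambda>S. \<Sum>a\<in>S. scale (Poly_Mapping.lookup p a) (basis_vec a)"
  \<comment> \<open>The support condition is carried along in the induction, since additivity may be
    used only for partial sums inside the carrier.\<close>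
  have "Poly_Mapping.keys (?sum S) \<subseteq> B \<and> f (?sum S) = g (?sum S)" if "finite S" "S \<subseteq> B" for S
    using that
  proof (induction S rule: finite_induct)
    case empty
    then show ?case using linear_map_zero[OF f] linear_map_zero[OF g] by simp
  next
    case (insert a S)
    let ?v = "scale (Poly_Mapping.lookup p a) (basis_vec a)"
    have S: "Poly_Mapping.keys (?sum S) \<subseteq> B" "f (?sum S) = g (?sum S)" and a: "a \<in> B"
      using insert by auto
    then have v: "Poly_Mapping.keys ?v \<subseteq> B" by simp
    have "f ?v = g ?v"
      using f g a eq[OF a] by (simp add: linear_map_class_ring_iff del: scale_single)
    then have "f (?v + ?sum S) = g (?v + ?sum S)"
      using f g S v by (simp add: linear_map_class_ring_iff del: scale_single)
    then show ?case
      using insert(1,2) keys_add_subset[OF v S(1)] by (simp del: scale_single)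
  qed
  from this[OF finite_keys p] show ?thesis
    unfolding sum_basis_vec by simp
qed

lemma free_lift_basis:
  fixes V :: "('k :: field, 'v, 'z) module_scheme"
  assumes "vectorspace class_ring V" "\<phi> a \<in> carrier V"
  shows "free_lift V \<phi> (basis_vec a) = \<phi> a"
proof -
  interpret V: vectorspace class_ring V by (rule assms)
  show ?thesis using assms(2) V.smult_one by (simp add: free_lift_def)
qed

lemma linear_map_free_lift:
  fixes V :: "('k :: field, 'v, 'z) module_scheme"
  assumes V: "vectorspace class_ring V" and \<phi>: "\<And>a. a \<in> B \<Longrightarrow> \<phi> a \<in> carrier V"
  shows "linear_map class_ring (free_space B) V (free_lift V \<phi>)"
proof -
  interpret V: vectorspace class_ring V by (rule V)
  have term_closed: "c \<odot>\<^bsub>V\<^esub> \<phi> a \<in> carrier V" if "a \<in> B" for a c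
    using V.smult_closed \<phi>[OF that] by simp
  have term_assoc: "(c * d) \<odot>\<^bsub>V\<^esub> \<phi> a = c \<odot>\<^bsub>V\<^esub> (d \<odot>\<^bsub>V\<^esub> \<phi> a)" if "a \<in> B" for a c d
    using V.smult_assoc1[of c d "\<phi> a"] \<phi>[OF that] by simp
  have term_distr: "(c + d) \<odot>\<^bsub>V\<^esub> \<phi> a = c \<odot>\<^bsub>V\<^esub> \<phi> a \<oplus>\<^bsub>V\<^esub> d \<odot>\<^bsub>V\<^esub> \<phi> a" if "a \<in> B" for a c d
    using V.smult_l_distr[of c d "\<phi> a"] \<phi>[OF that] by simp
  \<comment> \<open>As in \<open>lin_combination\<close>, the support is enlarged by zero terms;
    here \<open>S\<close> must stay inside \<open>B\<close>, where the values of \<phi> are known to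
    lie in \<open>V\<close>.\<close>
  have extend: "free_lift V \<phi> p = (\<Oplus>\<^bsub>V\<^esub>a\<in>S. Poly_Mapping.lookup p a \<odot>\<^bsub>V\<^esub> \<phi> a)"
    if "finite S" "Poly_Mapping.keys p \<subseteq> S" "S \<subseteq> B" for p S
    unfolding free_lift_def
  proof (rule V.add.finprod_mono_neutral_cong_left)
    fix a assume "a \<in> S - Poly_Mapping.keys p"
    then show "Poly_Mapping.lookup p a \<odot>\<^bsub>V\<^esub> \<phi> a = \<zero>\<^bsub>V\<^esub>"
      using V.smult_l_null[of "\<phi> a"] \<phi> that by (auto simp: in_keys_iff)
  qed (use that term_closed in auto)
  show ?thesis
    unfolding linear_map_class_ring_iff
  proof (intro conjI ballI allI vectorspace_free_space V; simp)
    fix p q :: "'a \<Rightarrow>\<^sub>0 'k" and c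
    assume p: "Poly_Mapping.keys p \<subseteq> B"
    show "free_lift V \<phi> p \<in> carrier V"
      unfolding free_lift_def using p term_closed by (intro V.finsum_closed) auto
    have "free_lift V \<phi> (scale c p)
        = (\<Oplus>\<^bsub>V\<^esub>a\<in>Poly_Mapping.keys p. c \<odot>\<^bsub>V\<^esub> (Poly_Mapping.lookup p a \<odot>\<^bsub>V\<^esub> \<phi> a))"
      unfolding extend[OF finite_keys keys_scale p] using p
      by (intro V.finsum_cong') (auto intro!: V.smult_closed \<phi> simp: term_assoc)
    also have "\<dots> = c \<odot>\<^bsub>V\<^esub> free_lift V \<phi> p"
      unfolding free_lift_def using p term_closed by (subst V.finsum_smult) auto
    finally show "free_lift V \<phi> (scale c p) = c \<odot>\<^bsub>V\<^esub> free_lift V \<phi> p" .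
    assume q: "Poly_Mapping.keys q \<subseteq> B"
    let ?S = "Poly_Mapping.keys p \<union> Poly_Mapping.keys q"
    have S: "finite ?S" "?S \<subseteq> B" using p q by auto
    have "free_lift V \<phi> (p + q)
        = (\<Oplus>\<^bsub>V\<^esub>a\<in>?S. Poly_Mapping.lookup p a \<odot>\<^bsub>V\<^esub> \<phi> a \<oplus>\<^bsub>V\<^esub> Poly_Mapping.lookup q a \<odot>\<^bsub>V\<^esub> \<phi> a)"
      unfolding extend[OF S(1) keys_add S(2)] using p q
      by (intro V.finsum_cong') (auto intro!: V.a_closed term_closed simp: lookup_add term_distr)
    also have "\<dots> = free_lift V \<phi> p \<oplus>\<^bsub>V\<^esub> free_lift V \<phi> q"
      using extend[of ?S p] extend[of ?S q] S term_closed by (subst V.finsum_addf) auto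
    finally show "free_lift V \<phi> (p + q) = free_lift V \<phi> p \<oplus>\<^bsub>V\<^esub> free_lift V \<phi> q" .
  qed
qed

text \<open>An operation \<open>h\<close> on basis elements that corresponds to a linear
  \<open>L\<close> on values corresponds to it on all vectors. Relabelling, grafting and joining at
  an angle are all treated this way, with \<open>L\<close> an arrow, the Rota--Baxter operator or a
  multiplication.\<close>

lemma free_lift_linear_ext:
  fixes V :: "('k :: field, 'v, 'z) module_scheme"
  assumes L: "linear_map class_ring V W L"
    and \<phi>: "\<And>a. a \<in> B \<Longrightarrow> \<phi> a \<in> carrier V"
    and \<psi>: "\<And>a. a \<in> B \<Longrightarrow> \<psi> (h a) = L (\<phi> a)"
    and p: "Poly_Mapping.keys p \<subseteq> B"
  shows "free_lift W \<psi> (linear_ext h p) = L (free_lift V \<phi> p)"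
proof (rule free_space_eqI[OF _ _ _ p])
  have V: "vectorspace class_ring V" and W: "vectorspace class_ring W"
    using L by (simp_all add: linear_map_class_ring_iff)
  have \<psi>_closed: "\<psi> b \<in> carrier W" if "b \<in> h ` B" for b
    using that \<phi> \<psi> linear_map_closed[OF L] by auto
  \<comment> \<open>The intermediate space is spanned by the image of \<open>B\<close> only, because
    the values of \<psi> are known to lie in \<open>W\<close> only there.\<close>
  have "linear_map class_ring (free_space B) (free_space (h ` B)) (linear_ext h)"
    by (intro linear_map_free_spaceI lin_linear_ext[OF lin_ident]
        order.trans[OF keys_linear_ext image_mono])
  then show "linear_map class_ring (free_space B) W (\<lambda>p. free_lift W \<psi> (linear_ext h p))"
    by (rule linear_map_compose) (rule linear_map_free_lift[OF W \<psi>_closed])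
  show "linear_map class_ring (free_space B) W (\<lambda>p. L (free_lift V \<phi> p))"
    by (rule linear_map_compose[OF linear_map_free_lift[OF V \<phi>] L])
  fix a assume "a \<in> B"
  then show "free_lift W \<psi> (linear_ext h (basis_vec a)) = L (free_lift V \<phi> (basis_vec a))"
    using free_lift_basis[of V \<phi> a, OF V] free_lift_basis[of W \<psi> "h a", OF W] \<phi> \<psi>
      \<psi>_closed[of "h a"] by simp
qed

section \<open>The universal property\<close>

context twisted_algebra
begin

lemma tprod_closed:
  assumes "finite X" "finite Y" "X \<inter> Y = {}" "a \<in> carrier (obj P X)" "b \<in> carrier (obj P Y)"
  shows "tprod P X Y a b \<in> carrier (obj P (X \<union> Y))"
  using linear_map_closed[OF tprod_linear_right[OF assms(1-4)] assms(5)] .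

text \<open>The left side brackets its first three factors as \<open>forest_value\<close> does for
  \<open>T x F\<close>; the right side is the form reached after a further factor has been moved
  inside.\<close>

lemma tprod_assoc4:
  assumes "finite X" "finite Y" "finite Z" "finite W"
    and "X \<inter> Y = {}" "X \<inter> Z = {}" "X \<inter> W = {}" "Y \<inter> Z = {}" "Y \<inter> W = {}" "Z \<inter> W = {}"
    and "a \<in> carrier (obj P X)" "b \<in> carrier (obj P Y)" "c \<in> carrier (obj P Z)"
    and "d \<in> carrier (obj P W)"
  shows "tprod P (X \<union> (Y \<union> Z)) W (tprod P X (Y \<union> Z) a (tprod P Y Z b c)) d
    = tprod P X (Y \<union> (Z \<union> W)) a (tprod P Y (Z \<union> W) b (tprod P Z W c d))"
proof -
  have disj: "X \<inter> (Y \<union> Z) = {}" "(Y \<union> Z) \<inter> W = {}" using assms by auto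
  have "tprod P (X \<union> (Y \<union> Z)) W (tprod P X (Y \<union> Z) a (tprod P Y Z b c)) d
      = tprod P X ((Y \<union> Z) \<union> W) a (tprod P (Y \<union> Z) W (tprod P Y Z b c) d)"
    using assms disj tprod_closed by (intro tprod_assoc) auto
  also have "tprod P (Y \<union> Z) W (tprod P Y Z b c) d = tprod P Y (Z \<union> W) b (tprod P Z W c d)"
    using assms by (intro tprod_assoc) auto
  finally show ?thesis by (simp only: Un_assoc)
qed

text \<open>All functions agree on the empty set, so each of them is the identity arrow
  there.\<close>

lemma arr_tunit: "arr P {} \<sigma> (tunit P) = tunit P"
  using arr_cong[of "{}" id "{}" \<sigma> "tunit P"] arr_id[of "{}" "tunit P"] tunit_closed by simp

end

section \<open>Values of forests in a target species\<close>

locale rota_baxter_generated = rota_baxter_species Q lam + gen: species_morphism O_species Q g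
  for Q :: "('x, 'k :: field_char_0, 'v, 'z) rota_baxter_data_scheme"
    and lam :: 'k
    and g :: "'x set \<Rightarrow> ('x adforest \<Rightarrow>\<^sub>0 'k) \<Rightarrow> 'v"
begin

definition generator :: "'x \<Rightarrow> 'v" where
  "generator x = g {x} (basis_vec (bullet_angle_bullet x))"

text \<open>The index sets required by the operations of \<open>Q\<close> are the decoration sets of
  the parts. Repeated decorations make these sets overlap, where the axioms of \<open>Q\<close> say
  nothing; hence the \<open>distinct\<close> hypotheses below.\<close>

primrec tree_value :: "'x adtree \<Rightarrow> 'v" and forest_value :: "'x adforest \<Rightarrow> 'v" where
  "tree_value Bullet = tunit Q"
| "tree_value (Bplus F) = rb_op Q (set (forest_angles F)) (forest_value F)"
| "forest_value (Tree T) = tree_value T"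
| "forest_value (Angle T x F) = tprod Q (set (tree_angles T)) ({x} \<union> set (forest_angles F))
    (tree_value T) (tprod Q {x} (set (forest_angles F)) (generator x) (forest_value F))"

definition extension :: "'x set \<Rightarrow> ('x adforest \<Rightarrow>\<^sub>0 'k) \<Rightarrow> 'v" where
  "extension X = free_lift (obj Q X) forest_value"

lemma generator_closed: "generator x \<in> carrier (obj Q {x})"
  unfolding generator_def by (rule linear_map_closed[OF gen.linear]) auto

lemma rb_op_closed: "finite X \<Longrightarrow> a \<in> carrier (obj Q X) \<Longrightarrow> rb_op Q X a \<in> carrier (obj Q X)"
  using linear_map_closed[OF rb.linear] .

lemma value_closed:
  "distinct (tree_angles T) \<Longrightarrow> tree_value T \<in> carrier (obj Q (set (tree_angles T)))"
  "distinct (forest_angles F) \<Longrightarrow> forest_value F \<in> carrier (obj Q (set (forest_angles F)))"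
proof (induction T and F)
  case (Angle T x F)
  then have "forest_value (Angle T x F)
      \<in> carrier (obj Q (set (tree_angles T) \<union> ({x} \<union> set (forest_angles F))))"
    unfolding forest_value.simps by (intro tprod_closed generator_closed) auto
  then show ?case by simp
qed (auto simp: tunit_closed rb_op_closed)

lemma forest_value_closed: "F \<in> decorated_forests X \<Longrightarrow> forest_value F \<in> carrier (obj Q X)"
  using value_closed(2)[of F] by (auto simp: decorated_forests_def)

lemma finite_decoration: "F \<in> decorated_forests X \<Longrightarrow> finite X"
  by (auto simp: decorated_forests_def)

lemma extension_linear:
  "finite X \<Longrightarrow> linear_map class_ring (free_space (decorated_forests X)) (obj Q X) (extension X)"
  unfolding extension_def by (intro linear_map_free_lift obj_vectorspace forest_value_closed)

lemma extension_basis: "F \<in> decorated_forests X \<Longrightarrow> extension X (basis_vec F) = forest_value F"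
  unfolding extension_def
  by (intro free_lift_basis obj_vectorspace forest_value_closed finite_decoration)

lemma extension_linear_ext:
  assumes "linear_map class_ring (obj Q X) (obj Q Y) L"
    and "\<And>F. F \<in> decorated_forests X \<Longrightarrow> forest_value (h F) = L (forest_value F)"
    and "Poly_Mapping.keys p \<subseteq> decorated_forests X"
  shows "extension Y (linear_ext h p) = L (extension X p)"
  unfolding extension_def
  by (rule free_lift_linear_ext[OF assms(1) _ _ assms(3)]) (simp_all add: forest_value_closed assms(2))

text \<open>The defining equation covers a single tree left of the angle. Associativity extends it
  to a forest, as needed for products whose right factor has an angle.\<close>

lemma forest_value_join:
  assumes "distinct (forest_angles F @ x # forest_angles G)"
  shows "forest_value (join_forests F x G)
    = tprod Q (set (forest_angles F)) ({x} \<union> set (forest_angles G)) (forest_value F)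
        (tprod Q {x} (set (forest_angles G)) (generator x) (forest_value G))"
  using assms
proof (induction F rule: adforest.induct[of "\<lambda>_. True"])
  case (Angle T y F)
  let ?T = "set (tree_angles T)" and ?F = "set (forest_angles F)" and ?G = "set (forest_angles G)"
  let ?xG = "tprod Q {x} ?G (generator x) (forest_value G)"
  have G: "?xG \<in> carrier (obj Q ({x} \<union> ?G))"
    using Angle.prems by (intro tprod_closed generator_closed value_closed) auto
  have "forest_value (join_forests (Angle T y F) x G)
      = tprod Q ?T ({y} \<union> (?F \<union> ({x} \<union> ?G))) (tree_value T)
          (tprod Q {y} (?F \<union> ({x} \<union> ?G)) (generator y)
            (tprod Q ?F ({x} \<union> ?G) (forest_value F) ?xG))"
    using Angle by simp
  also have "\<dots> = tprod Q (?T \<union> ({y} \<union> ?F)) ({x} \<union> ?G)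
      (tprod Q ?T ({y} \<union> ?F) (tree_value T) (tprod Q {y} ?F (generator y) (forest_value F))) ?xG"
    using Angle.prems G by (intro tprod_assoc4[symmetric] generator_closed value_closed) auto
  finally show ?case by simp
qed auto

lemma forest_value_map:
  "distinct (tree_angles T) \<Longrightarrow> inj_on \<sigma> (set (tree_angles T))
    \<Longrightarrow> tree_value (map_adtree \<sigma> T) = arr Q (set (tree_angles T)) \<sigma> (tree_value T)"
  "distinct (forest_angles F) \<Longrightarrow> inj_on \<sigma> (set (forest_angles F))
    \<Longrightarrow> forest_value (map_adforest \<sigma> F) = arr Q (set (forest_angles F)) \<sigma> (forest_value F)"
proof (induction T and F)
  case Bullet
  then show ?case by (simp add: arr_tunit)
next
  case (Bplus F)
  then have "rb_op Q (\<sigma> ` set (forest_angles F)) (arr Q (set (forest_angles F)) \<sigma> (forest_value F))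
      = arr Q (set (forest_angles F)) \<sigma> (rb_op Q (set (forest_angles F)) (forest_value F))"
    by (intro rb.natural value_closed) (auto simp: bij_betw_def)
  then show ?case using Bplus by simp
next
  case (Tree T)
  then show ?case by simp
next
  case (Angle T x F)
  let ?T = "set (tree_angles T)" and ?F = "set (forest_angles F)"
  have inj: "inj_on \<sigma> ?T" "inj_on \<sigma> ?F" "inj_on \<sigma> ({x} \<union> ?F)" "inj_on \<sigma> (?T \<union> ({x} \<union> ?F))"
    using Angle.prems(2) by (auto elim: inj_on_subset)
  have xF: "tprod Q {x} ?F (generator x) (forest_value F) \<in> carrier (obj Q ({x} \<union> ?F))"
    using Angle.prems by (intro tprod_closed generator_closed value_closed) auto
  \<comment> \<open>Naturality of \<open>g\<close> along the bijection from \<open>{x}\<close> to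
    \<open>{\<sigma> x}\<close>.\<close>
  have "generator (\<sigma> x) = arr Q {x} \<sigma> (generator x)"
    using gen.natural[of "{x}" \<sigma> "{\<sigma> x}" "basis_vec (bullet_angle_bullet x)"]
    by (simp add: generator_def bullet_angle_bullet_def bij_betw_def)
  then have "forest_value (map_adforest \<sigma> (Angle T x F))
      = tprod Q (\<sigma> ` ?T) (\<sigma> ` ({x} \<union> ?F)) (arr Q ?T \<sigma> (tree_value T))
          (tprod Q (\<sigma> ` {x}) (\<sigma> ` ?F) (arr Q {x} \<sigma> (generator x)) (arr Q ?F \<sigma> (forest_value F)))"
    using Angle inj by simp
  also have "tprod Q (\<sigma> ` {x}) (\<sigma> ` ?F) (arr Q {x} \<sigma> (generator x)) (arr Q ?F \<sigma> (forest_value F))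
      = arr Q ({x} \<union> ?F) \<sigma> (tprod Q {x} ?F (generator x) (forest_value F))"
    using Angle.prems inj
    by (intro tprod_natural[symmetric] generator_closed value_closed) auto
  also have "tprod Q (\<sigma> ` ?T) (\<sigma> ` ({x} \<union> ?F)) (arr Q ?T \<sigma> (tree_value T))
        (arr Q ({x} \<union> ?F) \<sigma> (tprod Q {x} ?F (generator x) (forest_value F)))
      = arr Q (?T \<union> ({x} \<union> ?F)) \<sigma> (forest_value (Angle T x F))"
    unfolding forest_value.simps using Angle.prems inj xF
    by (intro tprod_natural[symmetric] value_closed) auto
  finally show ?case by simp
qed

section \<open>Compatibility with grafting and with the product\<close>

lemma extension_graft:
  assumes "finite X" "Poly_Mapping.keys p \<subseteq> decorated_forests X"
  shows "extension X (graft p) = rb_op Q X (extension X p)"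
  unfolding graft_def
  by (rule extension_linear_ext[OF rb.linear[OF assms(1)] _ assms(2)])
    (auto simp: decorated_forests_def)

lemma extension_forest_diamond:
  assumes "distinct (forest_angles F @ forest_angles G)"
  shows "extension (set (forest_angles F) \<union> set (forest_angles G)) (forest_diamond lam F G)
    = tprod Q (set (forest_angles F)) (set (forest_angles G)) (forest_value F) (forest_value G)"
  using assms
proof (induction F G rule: forest_pair_induct)
  case (unit_left G)
  then show ?case
    using extension_basis[of G "set (forest_angles G)"] value_closed(2)[of G]
    by (simp add: forest_diamond_unit_left tunit_left decorated_forests_def)
next
  case (unit_right F)
  then show ?case
    using extension_basis[of F "set (forest_angles F)"] value_closed(2)[of F]
    by (simp add: forest_diamond_unit_right tunit_right decorated_forests_def)
next
  case (graft F G)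
  let ?X = "set (forest_angles F)" and ?Y = "set (forest_angles G)"
  let ?ext = "extension (?X \<union> ?Y)"
  let ?p = "forest_diamond lam (Tree (Bplus F)) G" and ?q = "forest_diamond lam F (Tree (Bplus G))"
    and ?r = "forest_diamond lam F G"
  have F: "F \<in> decorated_forests ?X" "Tree (Bplus F) \<in> decorated_forests ?X"
    and G: "G \<in> decorated_forests ?Y" "Tree (Bplus G) \<in> decorated_forests ?Y"
    and disj: "?X \<inter> ?Y = {}"
    using graft.prems by (auto simp: decorated_forests_def)
  have keys: "Poly_Mapping.keys ?p \<subseteq> decorated_forests (?X \<union> ?Y)"
    "Poly_Mapping.keys ?q \<subseteq> decorated_forests (?X \<union> ?Y)"
    "Poly_Mapping.keys (scale lam ?r) \<subseteq> decorated_forests (?X \<union> ?Y)"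
    "Poly_Mapping.keys ?r \<subseteq> decorated_forests (?X \<union> ?Y)"
    by (intro keys_scale_subset forest_diamond_decorated F G disj)+
  have "?ext (forest_diamond lam (Tree (Bplus F)) (Tree (Bplus G)))
      = rb_op Q (?X \<union> ?Y) (?ext (?p + ?q + scale lam ?r))"
    unfolding forest_diamond_graft using keys by (intro extension_graft keys_add_subset) auto
  also have "?ext (?p + ?q + scale lam ?r) = ?ext ?p \<oplus>\<^bsub>obj Q (?X \<union> ?Y)\<^esub> ?ext ?q
      \<oplus>\<^bsub>obj Q (?X \<union> ?Y)\<^esub> lam \<odot>\<^bsub>obj Q (?X \<union> ?Y)\<^esub> ?ext ?r"
    using extension_linear[of "?X \<union> ?Y"] keys keys_add_subset[OF keys(1,2)]
    by (simp add: linear_map_class_ring_iff)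
  \<comment> \<open>The induction hypotheses turn the three summands into products in
    \<open>Q\<close>, which together form the argument on the right of the Rota--Baxter identity of
    \<open>Q\<close>.\<close>
  also have "rb_op Q (?X \<union> ?Y) \<dots>
      = tprod Q ?X ?Y (rb_op Q ?X (forest_value F)) (rb_op Q ?Y (forest_value G))"
    using graft disj F G forest_value_closed by (subst rota_baxter) auto
  finally show ?case by simp
next
  case (angle_left T x F G)
  let ?T = "set (tree_angles T)" and ?F = "set (forest_angles F)" and ?G = "set (forest_angles G)"
  \<comment> \<open>Putting \<open>T x\<close> in front of a forest becomes left multiplication in
    \<open>Q\<close>. As this is linear, it can be pulled out of the extension, and the induction
    hypothesis applies to what remains.\<close>
  let ?L = "\<lambda>v. tprod Q ?T ({x} \<union> (?F \<union> ?G)) (tree_value T) (tprod Q {x} (?F \<union> ?G) (generator x) v)"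
  have T: "tree_value T \<in> carrier (obj Q ?T)"
    using angle_left.prems by (intro value_closed) auto
  have disj: "{x} \<inter> (?F \<union> ?G) = {}" "?T \<inter> ({x} \<union> (?F \<union> ?G)) = {}"
    using angle_left.prems by auto
  have "linear_map class_ring (obj Q (?F \<union> ?G)) (obj Q (?T \<union> ({x} \<union> (?F \<union> ?G)))) ?L"
    using T disj
    by (intro linear_map_compose[OF tprod_linear_right tprod_linear_right] generator_closed) auto
  moreover have "forest_value (Angle T x K) = ?L (forest_value K)"
    if "K \<in> decorated_forests (?F \<union> ?G)" for K
    using that by (simp add: decorated_forests_def)
  moreover have "Poly_Mapping.keys (forest_diamond lam F G) \<subseteq> decorated_forests (?F \<union> ?G)"
    using angle_left.prems by (intro forest_diamond_decorated) (auto simp: decorated_forests_def)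
  ultimately have "extension (?T \<union> ({x} \<union> (?F \<union> ?G))) (linear_ext (Angle T x) (forest_diamond lam F G))
      = ?L (extension (?F \<union> ?G) (forest_diamond lam F G))"
    by (rule extension_linear_ext)
  also have "\<dots> = ?L (tprod Q ?F ?G (forest_value F) (forest_value G))"
    using angle_left by simp
  also have "\<dots> = tprod Q (?T \<union> ({x} \<union> ?F)) ?G (forest_value (Angle T x F)) (forest_value G)"
    unfolding forest_value.simps using angle_left.prems
    by (intro tprod_assoc4[symmetric] generator_closed value_closed) auto
  finally show ?case by (simp add: forest_diamond.simps Un_assoc)
next
  case (angle_right F T y G)
  let ?F = "set (forest_angles F)" and ?T = "set (tree_angles T)" and ?G = "set (forest_angles G)"
  let ?yG = "tprod Q {y} ?G (generator y) (forest_value G)"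
  \<comment> \<open>The mirror image: joining \<open>y G\<close> on the right becomes right
    multiplication by \<open>?yG\<close>. The forests \<open>K\<close> in the product of
    \<open>F\<close> and \<open>T\<close> may have several trees, so
    \<open>forest_value_join\<close> replaces the defining equation.\<close>
  let ?L = "\<lambda>v. tprod Q (?F \<union> ?T) ({y} \<union> ?G) v ?yG"
  have yG: "?yG \<in> carrier (obj Q ({y} \<union> ?G))"
    using angle_right.prems by (intro tprod_closed generator_closed value_closed) auto
  have disj: "(?F \<union> ?T) \<inter> ({y} \<union> ?G) = {}" using angle_right.prems by auto
  have "linear_map class_ring (obj Q (?F \<union> ?T)) (obj Q ((?F \<union> ?T) \<union> ({y} \<union> ?G))) ?L"
    using disj yG by (intro tprod_linear_left) auto
  moreover have "forest_value (join_forests K y G) = ?L (forest_value K)"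
    if "K \<in> decorated_forests (?F \<union> ?T)" for K
    using that angle_right.prems disj by (subst forest_value_join) (auto simp: decorated_forests_def)
  moreover have "Poly_Mapping.keys (forest_diamond lam F (Tree T)) \<subseteq> decorated_forests (?F \<union> ?T)"
    using angle_right.prems by (intro forest_diamond_decorated) (auto simp: decorated_forests_def)
  ultimately have "extension ((?F \<union> ?T) \<union> ({y} \<union> ?G))
        (linear_ext (\<lambda>K. join_forests K y G) (forest_diamond lam F (Tree T)))
      = ?L (extension (?F \<union> ?T) (forest_diamond lam F (Tree T)))"
    by (rule extension_linear_ext)
  also have "\<dots> = ?L (tprod Q ?F ?T (forest_value F) (tree_value T))"
    using angle_right by (simp add: Int_Un_distrib)
  also have "\<dots> = tprod Q ?F (?T \<union> ({y} \<union> ?G)) (forest_value F) (forest_value (Angle T y G))"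
    unfolding forest_value.simps using angle_right.prems yG
    by (intro tprod_assoc value_closed) auto
  finally show ?case by (simp add: forest_diamond_Angle_right Un_assoc)
qed

text \<open>Linearity in \<open>Q\<close> is available only on carriers, so the reduction to basis
  forests is made one argument at a time, the right one before the left one.\<close>

lemma extension_diamond:
  assumes "finite X" "finite Y" "X \<inter> Y = {}"
    and p: "Poly_Mapping.keys p \<subseteq> decorated_forests X"
    and q: "Poly_Mapping.keys q \<subseteq> decorated_forests Y"
  shows "extension (X \<union> Y) (diamond lam p q) = tprod Q X Y (extension X p) (extension Y q)"
proof -
  interpret ADF: twisted_algebra "ADF lam :: ('x, 'k, 'x adforest \<Rightarrow>\<^sub>0 'k) rota_baxter_data"
    by (rule twisted_algebra_ADF)
  have fin: "finite (X \<union> Y)" using assms by simp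
  note diamond_right = ADF.tprod_linear_right[OF assms(1-3), simplified]
    and diamond_left = ADF.tprod_linear_left[OF assms(1-3), simplified]
  have basis: "extension (X \<union> Y) (diamond lam (basis_vec F) q)
      = tprod Q X Y (extension X (basis_vec F)) (extension Y q)"
    if F: "F \<in> decorated_forests X" for F
  proof (rule free_space_eqI[OF _ _ _ q])
    show "linear_map class_ring (free_space (decorated_forests Y)) (obj Q (X \<union> Y))
        (\<lambda>q. extension (X \<union> Y) (diamond lam (basis_vec F) q))"
      using F by (intro linear_map_compose[OF diamond_right extension_linear[OF fin]]) simp
    show "linear_map class_ring (free_space (decorated_forests Y)) (obj Q (X \<union> Y))
        (\<lambda>q. tprod Q X Y (extension X (basis_vec F)) (extension Y q))"
      using F assms by (intro linear_map_compose[OF extension_linear tprod_linear_right])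
        (auto simp: extension_basis forest_value_closed)
    fix G assume G: "G \<in> decorated_forests Y"
    show "extension (X \<union> Y) (diamond lam (basis_vec F) (basis_vec G))
        = tprod Q X Y (extension X (basis_vec F)) (extension Y (basis_vec G))"
      using extension_forest_diamond[of F G] F G \<open>X \<inter> Y = {}\<close>
      by (simp add: extension_basis[OF F] extension_basis[OF G]) (simp add: decorated_forests_def)
  qed
  have ext_q: "extension Y q \<in> carrier (obj Q Y)"
    using linear_map_closed[OF extension_linear] assms by simp
  show ?thesis
  proof (rule free_space_eqI[OF _ _ _ p])
    show "linear_map class_ring (free_space (decorated_forests X)) (obj Q (X \<union> Y))
        (\<lambda>p. extension (X \<union> Y) (diamond lam p q))"
      using q by (intro linear_map_compose[OF diamond_left extension_linear[OF fin]]) simp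
    show "linear_map class_ring (free_space (decorated_forests X)) (obj Q (X \<union> Y))
        (\<lambda>p. tprod Q X Y (extension X p) (extension Y q))"
      using assms ext_q by (intro linear_map_compose[OF extension_linear tprod_linear_left])
  qed (rule basis)
qed

section \<open>Existence of the extending morphism\<close>

lemma rota_baxter_morphism_extension: "rota_baxter_morphism (ADF lam) Q extension"
proof (intro rota_baxter_morphism.intro species_morphism.intro species_morphism_axioms.intro
    rota_baxter_morphism_axioms.intro species_ADF species_axioms)
  fix X Y :: "'x set" and \<sigma> v
  assume \<sigma>: "finite X" "bij_betw \<sigma> X Y" and v: "v \<in> carrier (obj (ADF lam) X)"
  show "extension Y (arr (ADF lam) X \<sigma> v) = arr Q X \<sigma> (extension X v)"
    unfolding ADF_sel
  proof (rule extension_linear_ext[OF arr_linear[OF \<sigma>]])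
    fix F assume "F \<in> decorated_forests X"
    then show "forest_value (map_adforest \<sigma> F) = arr Q X \<sigma> (forest_value F)"
      using forest_value_map(2)[of F \<sigma>] \<sigma> by (auto simp: decorated_forests_def bij_betw_def)
  qed (use v in simp)
next
  show "extension {} (tunit (ADF lam)) = tunit Q"
    using extension_basis[of "Tree Bullet" "{}"] by (simp add: decorated_forests_def)
qed (simp_all add: extension_linear extension_graft extension_diamond)

text \<open>Unless \<open>X\<close> is a singleton, \<open>?B\<close> is empty and both maps are
  determined by linearity; only the generator needs a computation.\<close>

lemma extension_incl:
  assumes "finite X" "p \<in> carrier (obj O_species X)"
  shows "extension X (incl X p) = g X p"
proof (rule free_space_eqI)
  interpret incl: species_morphism O_species
    "ADF lam :: ('x, 'k, 'x adforest \<Rightarrow>\<^sub>0 'k) rota_baxter_data" incl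
    by (rule species_morphism_incl)
  let ?B = "{bullet_angle_bullet x | x. X = {x}}"
  show "linear_map class_ring (free_space ?B) (obj Q X) (\<lambda>p. extension X (incl X p))"
    using linear_map_compose[OF incl.linear[OF assms(1)]] extension_linear[OF assms(1)] by simp
  show "linear_map class_ring (free_space ?B) (obj Q X) (g X)"
    using gen.linear[OF assms(1)] by simp
  show "Poly_Mapping.keys p \<subseteq> ?B"
    using assms(2) by simp
  fix F assume "F \<in> ?B"
  then obtain x where x: "X = {x}" "F = bullet_angle_bullet x" by auto
  then have "extension X (incl X (basis_vec F)) = forest_value (bullet_angle_bullet x)"
    using extension_basis[of F X] by (simp add: incl_def decorated_forests_def bullet_angle_bullet_def)
  \<comment> \<open>The recursion gives the generator multiplied by the unit on both sides, one unit
    for each \<bullet>.\<close>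
  also have "\<dots> = generator x"
    using generator_closed[of x] by (simp add: bullet_angle_bullet_def tunit_left tunit_right)
  finally show "extension X (incl X (basis_vec F)) = g X (basis_vec F)"
    by (simp add: generator_def x)
qed

section \<open>Uniqueness of the extending morphism\<close>

context
  fixes h
  assumes h: "rota_baxter_morphism (ADF lam) Q h"
    and h_incl: "\<And>X p. finite X \<Longrightarrow> p \<in> carrier (obj O_species X) \<Longrightarrow> h X (incl X p) = g X p"
begin

interpretation h: rota_baxter_morphism
  "ADF lam :: ('x, 'k, 'x adforest \<Rightarrow>\<^sub>0 'k) rota_baxter_data" Q h
  by (rule h)

lemma morphism_generator: "h {x} (basis_vec (bullet_angle_bullet x)) = generator x"
  using h_incl[of "{x}" "basis_vec (bullet_angle_bullet x)"] by (simp add: generator_def incl_def)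

lemma morphism_basis:
  "distinct (tree_angles T) \<Longrightarrow> h (set (tree_angles T)) (basis_vec (Tree T)) = tree_value T"
  "distinct (forest_angles F) \<Longrightarrow> h (set (forest_angles F)) (basis_vec F) = forest_value F"
proof (induction T and F)
  case Bullet
  then show ?case using h.tunit_hom by simp
next
  case (Bplus F)
  then show ?case
    using h.rb_op_hom[of "set (forest_angles F)" "basis_vec F"] by (simp add: decorated_forests_def)
next
  case (Tree T)
  then show ?case by simp
next
  case (Angle T x F)
  let ?T = "set (tree_angles T)" and ?F = "set (forest_angles F)"
  \<comment> \<open>Each product below fuses a \<bullet> with another tree. Since \<bullet> is
    neutral, the result is a single basis vector, and multiplicativity of \<open>h\<close>
    determines its value.\<close>
  have xF: "diamond lam (basis_vec (bullet_angle_bullet x)) (basis_vec F) = basis_vec (Angle Bullet x F)"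
    by (simp add: bullet_angle_bullet_def forest_diamond.simps forest_diamond_unit_left)
  have TxF: "diamond lam (basis_vec (Tree T)) (basis_vec (Angle Bullet x F)) = basis_vec (Angle T x F)"
    by (simp add: forest_diamond.simps)
  have "h ({x} \<union> ?F) (basis_vec (Angle Bullet x F)) = tprod Q {x} ?F (generator x) (forest_value F)"
    using h.tprod_hom[of "{x}" ?F "basis_vec (bullet_angle_bullet x)" "basis_vec F"] Angle xF
    by (simp add: morphism_generator[unfolded bullet_angle_bullet_def] decorated_forests_def
        bullet_angle_bullet_def)
  moreover have "h (?T \<union> ({x} \<union> ?F)) (basis_vec (Angle T x F))
      = tprod Q ?T ({x} \<union> ?F) (tree_value T) (h ({x} \<union> ?F) (basis_vec (Angle Bullet x F)))"
    using h.tprod_hom[of ?T "{x} \<union> ?F" "basis_vec (Tree T)" "basis_vec (Angle Bullet x F)"] Angle TxF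
    by (simp add: decorated_forests_def)
  ultimately show ?case by simp
qed

text \<open>Equality is asserted on carriers over finite sets: elsewhere a morphism is an
  unconstrained function.\<close>

lemma extension_unique:
  assumes "finite X" "p \<in> carrier (obj (ADF lam) X)"
  shows "h X p = extension X p"
proof (rule free_space_eqI)
  show "linear_map class_ring (free_space (decorated_forests X)) (obj Q X) (h X)"
    using h.linear[OF assms(1)] by simp
  show "linear_map class_ring (free_space (decorated_forests X)) (obj Q X) (extension X)"
    by (rule extension_linear[OF assms(1)])
  show "Poly_Mapping.keys p \<subseteq> decorated_forests X" using assms(2) by simp
  fix F assume "F \<in> decorated_forests X"
  then show "h X (basis_vec F) = extension X (basis_vec F)"
    using morphism_basis(2)[of F] extension_basis[of F X] by (auto simp: decorated_forests_def)
qed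

end

end

theorem theorem2p16:
  fixes lam :: "'k :: field_char_0"
  defines "A \<equiv> (ADF lam :: ('x :: infinite, 'k, 'x adforest \<Rightarrow>\<^sub>0 'k) rota_baxter_data)"
  shows "rota_baxter_species A lam
    \<and> species_morphism O_species A incl
    \<and> (\<forall>(Q :: ('x, 'k, 'v) rota_baxter_data) g.
        rota_baxter_species Q lam \<and> species_morphism O_species Q g \<longrightarrow>
        (\<exists>gbar. rota_baxter_morphism A Q gbar
          \<and> (\<forall>X. finite X \<longrightarrow> (\<forall>p \<in> carrier (obj O_species X). gbar X (incl X p) = g X p))
          \<and> (\<forall>h. rota_baxter_morphism A Q h
              \<and> (\<forall>X. finite X \<longrightarrow> (\<forall>p \<in> carrier (obj O_species X). h X (incl X p) = g X p))
              \<longrightarrow> (\<forall>X. finite X \<longrightarrow> (\<forall>p \<in> carrier (obj A X). h X p = gbar X p)))))"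
proof (intro conjI allI impI)
  show "rota_baxter_species A lam" "species_morphism O_species A incl"
    unfolding A_def by (rule rota_baxter_species_ADF species_morphism_incl)+
  fix Q :: "('x, 'k, 'v) rota_baxter_data" and g
  assume "rota_baxter_species Q lam \<and> species_morphism O_species Q g"
  then interpret rota_baxter_generated Q lam g
    by (simp add: rota_baxter_generated_def)
  show "\<exists>gbar. rota_baxter_morphism A Q gbar
      \<and> (\<forall>X. finite X \<longrightarrow> (\<forall>p \<in> carrier (obj O_species X). gbar X (incl X p) = g X p))
      \<and> (\<forall>h. rota_baxter_morphism A Q h
          \<and> (\<forall>X. finite X \<longrightarrow> (\<forall>p \<in> carrier (obj O_species X). h X (incl X p) = g X p))
          \<longrightarrow> (\<forall>X. finite X \<longrightarrow> (\<forall>p \<in> carrier (obj A X). h X p = gbar X p)))"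
    unfolding A_def
  proof (intro exI[of _ extension] conjI allI impI ballI)
    show "rota_baxter_morphism (ADF lam) Q extension"
      by (rule rota_baxter_morphism_extension)
    show "extension X (incl X p) = g X p" if "finite X" "p \<in> carrier (obj O_species X)" for X p
      using that by (rule extension_incl)
    show "h X p = extension X p"
      if "rota_baxter_morphism (ADF lam) Q h
          \<and> (\<forall>X. finite X \<longrightarrow> (\<forall>p \<in> carrier (obj O_species X). h X (incl X p) = g X p))"
        and "finite X" "p \<in> carrier (obj (ADF lam) X)" for h X p
      using that by (intro extension_unique) auto
  qed
qed

end
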